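(* For every $n\ge2$ and $\alpha\in(0,1/2)$ there is a constant $C_0>0$ depending only on $n$ and $\alpha$ such that the following holds. Let $\mathcal G=(V,E)$ be a connected, non-bipartite undirected graph with $V=[n]$, let $\mathbf X=(X_1,\dots,X_n)^\top$ have pairwise distinct real entries with ranks $r_1,\dots,r_n$ and $\alpha$-trimmed mean $\bar x_\alpha$, and let $\boldsymbol Z(t)$ be the (synchronous) Adaptive GoTrim estimate defined in the context. Then there exists $T^*>0$ such that for every integer $t>T^*$, $$\mathbb E\big\|\boldsymbol Z(t)-\bar x_\alpha\mathbf 1_n\big\|_2\le\frac{C_0}{\tilde c\sqrt{ct}}\cdot\big\|\mathbf K\odot(\mathbf X+|\bar x_\alpha|\mathbf 1_n)\big\|,$$ where $\mathbf K=\left(\frac{\sqrt6\,\sigma_n(r_i)}{\gamma_i(1-2\alpha)}\right)_{i=1}^n$, $\tilde c=1-\sqrt{\lambda_2(2)}$, $\lambda_2(2)=1-c/2$ is the second largest eigenvalue of $\mathbf W_2=\mathbf I_n-\frac12\mathbf L(P)$, and $c$ is the second smallest eigenvalue of $\mathbf L(P)=\sum_{e\in E}p_e\mathbf L_e$.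
   Context: Graph and edge sampling: $\mathcal G=(V,E)$ is a connected, non-bipartite undirected graph on $V=[n]=\{1,\dots,n\}$, $n\ge2$; $d_i$ is the degree of node $i$. Node $k$ holds the (fixed) real number $X_k$, with no ties. Edges $e_1,e_2,\dots$ are drawn i.i.d. from $E$, with edge $e=(i,j)$ having probability $p_e=\frac1n\left(\frac1{d_i}+\frac1{d_j}\right)$. For $e=(i,j)$ let $\mathbf L_e=(\mathbf e_i-\mathbf e_j)(\mathbf e_i-\mathbf e_j)^\top$, where $\mathbf e_1,\dots,\mathbf e_n$ is the canonical basis. Put $\mathbf W_1(s)=\mathbf I_n-\mathbf L_{e_s}$ (swapping matrix), $\mathbf W_2(s)=\mathbf I_n-\frac12\mathbf L_{e_s}$ (averaging matrix) and $\mathbf W_2(t{:}s)=\mathbf W_2(t)\mathbf W_2(t-1)\cdots\mathbf W_2(s)$. $\|\cdot\|=\|\cdot\|_2$ is the Euclidean norm, $\mathbf 1_n$ the all-ones vector, $\odot$ the entrywise product. Ranks and trimmed mean: $r_k=1+\sum_{l=1}^n\mathbb I_{\{X_k>X_l\}}$; $m=\lfloor\alpha n\rfloor$, $a=m+\frac12$, $b=n-m+\frac12$, $I_{n,\alpha}=[a,b]$, $c_{n,\alpha}=1-2m/n$, $w_{n,\alpha}(r)=\mathbb I_{\{r\in I_{n,\alpha}\}}/c_{n,\alpha}$, and $\bar x_\alpha=\frac1n\sum_{k=1}^nw_{n,\alpha}(r_k)X_k$. Moreover $\gamma_k=\min(|r_k-a|,|r_k-b|)$ and $\sigma_n(r_k)=n^{3/2}\phi((r_k-1)/n)$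 with $\phi(u)=\sqrt{u(1-u)}$. Synchronous rank estimates (all nodes update at every step): $Y_k(0)=X_k$, $\mathbf Y(s)=\mathbf W_1(s)\mathbf Y(s-1)$ for $s\ge1$, and $R_k(t)=1+\frac nt\sum_{s=1}^t\mathbb I_{\{X_k>Y_k(s-1)\}}$ for $t\ge1$. Adaptive GoTrim: $W_k(0)=0$, $W_k(s)=w_{n,\alpha}(R_k(s))$ for $s\ge1$, $\Delta\boldsymbol W(s)=\boldsymbol W(s)-\boldsymbol W(s-1)$ with $\boldsymbol W(s)=(W_1(s),\dots,W_n(s))^\top$, $$\boldsymbol N(t)=\sum_{s=1}^t\mathbf W_2(t{:}s)\big(\Delta\boldsymbol W(s)\odot\mathbf X\big),\qquad \boldsymbol M(t)=\sum_{s=1}^t\mathbf W_2(t{:}s)\big(\Delta\boldsymbol W(s)\odot\mathbf 1_n\big),$$ and $\boldsymbol Z(t)$ has entries $Z_k(t)=N_k(t)/\max(1,M_k(t))$. The same edges $e_s$ are used for averaging and swapping. *)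

theory Defs
  imports "HOL-Probability.Probability" "HOL-Library.Multiset"
begin

section \<open>Graphs on the node set \<open>UNIV\<close>\<close>

text \<open>The nodes are the elements of a finite type \<open>'n\<close>, so that \<open>n = CARD('n)\<close>; an undirected
  edge between \<open>i\<close> and \<open>j\<close> is the two-element set \<open>{i, j}\<close>.\<close>

definition undirected_graph :: "'n set set \<Rightarrow> bool" where
  "undirected_graph E \<longleftrightarrow> (\<forall>e\<in>E. \<exists>i j. i \<noteq> j \<and> e = {i, j})"

definition connected_graph :: "'n set set \<Rightarrow> bool" where
  "connected_graph E \<longleftrightarrow> (\<forall>i j. (i, j) \<in> {(k, l). {k, l} \<in> E}\<^sup>*)"

definition bipartite_graph :: "'n set set \<Rightarrow> bool" where
  "bipartite_graph E \<longleftrightarrow> (\<exists>A. \<forall>e\<in>E. \<exists>i j. e = {i, j} \<and> i \<in> A \<and> j \<notin> A)"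

definition node_degree :: "'n set set \<Rightarrow> 'n \<Rightarrow> nat" where
  "node_degree E i = card {e \<in> E. i \<in> e}"

definition edge_prob :: "('n::finite) set set \<Rightarrow> 'n set \<Rightarrow> real" where
  "edge_prob E e = 1 / real CARD('n) * (\<Sum>i\<in>e. 1 / real (node_degree E i))"

text \<open>The values of \<open>edge_prob\<close> on \<open>E\<close> sum to 1 for a connected graph with at least two nodes
  (\<open>pmf_edge_pmf\<close> below), which is what makes \<open>embed_pmf\<close> meaningful here.\<close>

definition edge_pmf :: "('n::finite) set set \<Rightarrow> 'n set pmf" where
  "edge_pmf E = embed_pmf (\<lambda>e. if e \<in> E then edge_prob E e else 0)"

text \<open>The law of an i.i.d. sequence of edges, as a product measure. A point \<open>\<omega>\<close> of the space is
  the edge sequence itself: \<open>\<omega> s\<close> is the edge drawn at step \<open>s \<ge> 1\<close>; the coordinate \<open>\<omega> 0\<close> is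
  never used.\<close>

definition edge_seq_measure :: "('n::finite) set set \<Rightarrow> (nat \<Rightarrow> 'n set) measure" where
  "edge_seq_measure E = Pi\<^sub>M UNIV (\<lambda>_. measure_pmf (edge_pmf E))"

section \<open>Swapping and averaging matrices\<close>

definition outer_self :: "real^'n \<Rightarrow> real^'n^'n" where
  "outer_self u = (columnvector u :: real^1^'n) ** rowvector u"

text \<open>The matrix does not depend on which end of the edge is called \<open>i\<close>; see
  \<open>edge_laplacian_eq\<close> below.\<close>

definition edge_laplacian :: "('n::finite) set \<Rightarrow> real^'n^'n" where
  "edge_laplacian e = (THE L. \<exists>i j. i \<noteq> j \<and> e = {i, j} \<and>
     L = outer_self (axis i 1 - axis j 1))"

definition swap_matrix :: "('n::finite) set \<Rightarrow> real^'n^'n" where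
  "swap_matrix e = mat 1 - edge_laplacian e"

definition avg_matrix :: "('n::finite) set \<Rightarrow> real^'n^'n" where
  "avg_matrix e = mat 1 - (1/2) *\<^sub>R edge_laplacian e"

text \<open>\<open>avg_prod \<omega> t s = avg_matrix (\<omega> t) ** \<dots> ** avg_matrix (\<omega> s)\<close> for \<open>1 \<le> s \<le> t\<close>.\<close>

primrec avg_prod :: "(nat \<Rightarrow> ('n::finite) set) \<Rightarrow> nat \<Rightarrow> nat \<Rightarrow> real^'n^'n" where
  "avg_prod \<omega> 0 s = mat 1"
| "avg_prod \<omega> (Suc t) s =
     (if s \<le> Suc t then avg_matrix (\<omega> (Suc t)) ** avg_prod \<omega> t s else mat 1)"

definition graph_laplacian :: "('n::finite) set set \<Rightarrow> real^'n^'n" where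
  "graph_laplacian E = (\<Sum>e\<in>E. edge_prob E e *\<^sub>R edge_laplacian e)"

definition mean_avg_matrix :: "('n::finite) set set \<Rightarrow> real^'n^'n" where
  "mean_avg_matrix E = mat 1 - (1/2) *\<^sub>R graph_laplacian E"

section \<open>Ordered eigenvalues of a symmetric matrix\<close>

text \<open>Each real eigenvalue is repeated as often as the dimension of its eigenspace. For symmetric
  matrices, the only ones considered here, this is also its algebraic multiplicity, and the sum
  below has a finite index set (\<open>finite_eigenvalues\<close>).\<close>

definition eigenspace :: "real^'n^'n \<Rightarrow> real \<Rightarrow> (real^'n) set" where
  "eigenspace A \<mu> = {v. A *v v = \<mu> *\<^sub>R v}"

definition eigenvalues :: "real^'n^'n \<Rightarrow> real set" where
  "eigenvalues A = {\<mu>. \<exists>v. v \<noteq> 0 \<and> A *v v = \<mu> *\<^sub>R v}"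

definition eigenvalue_mset :: "real^'n^'n \<Rightarrow> real multiset" where
  "eigenvalue_mset A = (\<Sum>\<mu>\<in>eigenvalues A. replicate_mset (dim (eigenspace A \<mu>)) \<mu>)"

definition second_smallest_eigenvalue :: "real^'n^'n \<Rightarrow> real" where
  "second_smallest_eigenvalue A = sorted_list_of_multiset (eigenvalue_mset A) ! 1"

definition second_largest_eigenvalue :: "real^'n^'n \<Rightarrow> real" where
  "second_largest_eigenvalue A = rev (sorted_list_of_multiset (eigenvalue_mset A)) ! 1"

section \<open>Ranks and the trimmed mean\<close>

definition rank_of :: "real^'n \<Rightarrow> 'n \<Rightarrow> real" where
  "rank_of X k = 1 + (\<Sum>l\<in>UNIV. of_bool (X $ k > X $ l))"

definition trim_m :: "nat \<Rightarrow> real \<Rightarrow> nat" where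
  "trim_m n \<alpha> = nat \<lfloor>\<alpha> * real n\<rfloor>"

definition trim_a :: "nat \<Rightarrow> real \<Rightarrow> real" where
  "trim_a n \<alpha> = real (trim_m n \<alpha>) + 1/2"

definition trim_b :: "nat \<Rightarrow> real \<Rightarrow> real" where
  "trim_b n \<alpha> = real n - real (trim_m n \<alpha>) + 1/2"

definition trim_c :: "nat \<Rightarrow> real \<Rightarrow> real" where
  "trim_c n \<alpha> = 1 - 2 * real (trim_m n \<alpha>) / real n"

definition trim_weight :: "nat \<Rightarrow> real \<Rightarrow> real \<Rightarrow> real" where
  "trim_weight n \<alpha> r = indicator {trim_a n \<alpha>..trim_b n \<alpha>} r / trim_c n \<alpha>"

definition trimmed_mean :: "real \<Rightarrow> real^'n \<Rightarrow> real" where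
  "trimmed_mean \<alpha> X =
     1 / real CARD('n) * (\<Sum>k\<in>UNIV. trim_weight CARD('n) \<alpha> (rank_of X k) * X $ k)"

definition rank_gap :: "real \<Rightarrow> real^'n \<Rightarrow> 'n \<Rightarrow> real" where
  "rank_gap \<alpha> X k = min \<bar>rank_of X k - trim_a CARD('n) \<alpha>\<bar> \<bar>rank_of X k - trim_b CARD('n) \<alpha>\<bar>"

definition rank_sigma :: "nat \<Rightarrow> real \<Rightarrow> real" where
  "rank_sigma n r = (let u = (r - 1) / real n in real n powr (3/2) * sqrt (u * (1 - u)))"

definition K_vec :: "real \<Rightarrow> real^'n \<Rightarrow> real^'n" where
  "K_vec \<alpha> X =
     (\<chi> i. sqrt 6 * rank_sigma CARD('n) (rank_of X i) / (rank_gap \<alpha> X i * (1 - 2 * \<alpha>)))"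

section \<open>Synchronous rank estimation and Adaptive GoTrim\<close>

primrec swapped_obs :: "real^'n \<Rightarrow> (nat \<Rightarrow> ('n::finite) set) \<Rightarrow> nat \<Rightarrow> real^'n" where
  "swapped_obs X \<omega> 0 = X"
| "swapped_obs X \<omega> (Suc s) = swap_matrix (\<omega> (Suc s)) *v swapped_obs X \<omega> s"

definition rank_estimate :: "real^'n \<Rightarrow> (nat \<Rightarrow> ('n::finite) set) \<Rightarrow> nat \<Rightarrow> 'n \<Rightarrow> real" where
  "rank_estimate X \<omega> t k =
     1 + real CARD('n) / real t * (\<Sum>s=1..t. of_bool (X $ k > swapped_obs X \<omega> (s - 1) $ k))"

definition weight_estimate ::
    "real \<Rightarrow> real^'n \<Rightarrow> (nat \<Rightarrow> ('n::finite) set) \<Rightarrow> nat \<Rightarrow> real^'n" where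
  "weight_estimate \<alpha> X \<omega> s =
     (if s = 0 then 0 else (\<chi> k. trim_weight CARD('n) \<alpha> (rank_estimate X \<omega> s k)))"

definition weight_increment ::
    "real \<Rightarrow> real^'n \<Rightarrow> (nat \<Rightarrow> ('n::finite) set) \<Rightarrow> nat \<Rightarrow> real^'n" where
  "weight_increment \<alpha> X \<omega> s = weight_estimate \<alpha> X \<omega> s - weight_estimate \<alpha> X \<omega> (s - 1)"

text \<open>On \<open>real^'n\<close>, \<open>*\<close> is the entrywise product and \<open>1\<close> is the all-ones vector.\<close>

definition gotrim_N :: "real \<Rightarrow> real^'n \<Rightarrow> (nat \<Rightarrow> ('n::finite) set) \<Rightarrow> nat \<Rightarrow> real^'n" where
  "gotrim_N \<alpha> X \<omega> t = (\<Sum>s=1..t. avg_prod \<omega> t s *v (weight_increment \<alpha> X \<omega> s * X))"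

definition gotrim_M :: "real \<Rightarrow> real^'n \<Rightarrow> (nat \<Rightarrow> ('n::finite) set) \<Rightarrow> nat \<Rightarrow> real^'n" where
  "gotrim_M \<alpha> X \<omega> t = (\<Sum>s=1..t. avg_prod \<omega> t s *v (weight_increment \<alpha> X \<omega> s * 1))"

definition gotrim_Z :: "real \<Rightarrow> real^'n \<Rightarrow> (nat \<Rightarrow> ('n::finite) set) \<Rightarrow> nat \<Rightarrow> real^'n" where
  "gotrim_Z \<alpha> X \<omega> t = (\<chi> k. gotrim_N \<alpha> X \<omega> t $ k / max 1 (gotrim_M \<alpha> X \<omega> t $ k))"

section \<open>Well-definedness of the definitions above\<close>

lemma edge_laplacian_eq:
  assumes "i \<noteq> (j :: 'n::finite)"
  shows "edge_laplacian {i, j} =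
    outer_self (axis i 1 - axis j 1)"
  unfolding edge_laplacian_def
proof (rule the_equality)
  show "\<exists>i' j'. i' \<noteq> j' \<and> {i, j} = {i', j'} \<and>
    outer_self (axis i 1 - axis j 1) =
    (outer_self (axis i' 1 - axis j' 1) :: real^'n^'n)"
    using assms by blast
next
  fix L :: "real^'n^'n"
  assume "\<exists>i' j'. i' \<noteq> j' \<and> {i, j} = {i', j'} \<and>
    L = outer_self (axis i' 1 - axis j' 1)"
  moreover have
    "outer_self (axis j 1 - axis i 1) =
     (outer_self (axis i 1 - axis j 1) :: real^'n^'n)"
    by (auto simp: vec_eq_iff outer_self_def matrix_matrix_mult_def columnvector_def rowvector_def algebra_simps)
  ultimately show
    "L = outer_self (axis i 1 - axis j 1)"
    by (auto simp: doubleton_eq_iff)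
qed

lemma node_degree_pos:
  assumes "connected_graph (E :: ('n::finite) set set)" "CARD('n) \<ge> 2"
  shows "node_degree E i > 0"
proof -
  obtain j where "j \<noteq> i"
    using assms(2) by (metis (full_types) UNIV_I card_le_Suc0_iff_eq finite not_less_eq_eq numeral_2_eq_2)
  moreover have "(i, j) \<in> {(k, l). {k, l} \<in> E}\<^sup>*"
    using assms(1) by (auto simp: connected_graph_def)
  ultimately obtain k where "{i, k} \<in> E"
    by (metis (mono_tags, lifting) converse_rtranclE mem_Collect_eq case_prodD)
  then have "{e \<in> E. i \<in> e} \<noteq> {}"
    by blast
  then show ?thesis
    by (simp add: node_degree_def card_gt_0_iff)
qed

lemma edge_prob_nonneg: "edge_prob E e \<ge> 0"
  unfolding edge_prob_def by (intro mult_nonneg_nonneg sum_nonneg) auto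

lemma sum_edge_prob:
  assumes "connected_graph (E :: ('n::finite) set set)" "CARD('n) \<ge> 2"
  shows "(\<Sum>e\<in>E. edge_prob E e) = 1"
proof -
  have "(\<Sum>e\<in>E. \<Sum>i\<in>e. 1 / real (node_degree E i)) =
      (\<Sum>e\<in>E. \<Sum>i\<in>{i \<in> UNIV. i \<in> e}. 1 / real (node_degree E i))"
    by simp
  also have "\<dots> = (\<Sum>i\<in>UNIV. \<Sum>e\<in>{e \<in> E. i \<in> e}. 1 / real (node_degree E i))"
    by (rule sum.swap_restrict) auto
  also have "\<dots> = (\<Sum>i\<in>(UNIV::'n set). 1)"
  proof (rule sum.cong)
    fix i :: 'n
    show "(\<Sum>e\<in>{e \<in> E. i \<in> e}. 1 / real (node_degree E i)) = 1"
      using node_degree_pos[OF assms, of i] by (simp flip: node_degree_def)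
  qed simp
  also have "\<dots> = real CARD('n)"
    by simp
  finally show ?thesis
    by (simp add: edge_prob_def flip: sum_divide_distrib)
qed

lemma pmf_edge_pmf:
  assumes "connected_graph (E :: ('n::finite) set set)" "CARD('n) \<ge> 2"
  shows "pmf (edge_pmf E) e = (if e \<in> E then edge_prob E e else 0)"
  unfolding edge_pmf_def
proof (rule pmf_embed_pmf)
  show "0 \<le> (if e \<in> E then edge_prob E e else 0)" for e
    by (simp add: edge_prob_nonneg)
  have "(\<integral>\<^sup>+e. ennreal (if e \<in> E then edge_prob E e else 0) \<partial>count_space UNIV) =
      (\<Sum>e\<in>UNIV. ennreal (if e \<in> E then edge_prob E e else 0))"
    by (rule nn_integral_count_space_finite) simp
  also have "\<dots> = ennreal (\<Sum>e\<in>UNIV. if e \<in> E then edge_prob E e else 0)"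
    by (rule sum_ennreal) (simp add: edge_prob_nonneg)
  also have "(\<Sum>e\<in>UNIV. if e \<in> E then edge_prob E e else 0) = 1"
    using sum_edge_prob[OF assms] by (simp add: sum.If_cases)
  finally show "(\<integral>\<^sup>+e. ennreal (if e \<in> E then edge_prob E e else 0) \<partial>count_space UNIV) = 1"
    by simp
qed

lemma finite_eigenvalues:
  fixes A :: "real^'n^'n"
  assumes "transpose A = A"
  shows "finite (eigenvalues A)"
proof -
  define f where "f = (\<lambda>\<mu>. SOME v. v \<noteq> 0 \<and> A *v v = \<mu> *\<^sub>R v)"
  have f: "f \<mu> \<noteq> 0 \<and> A *v f \<mu> = \<mu> *\<^sub>R f \<mu>" if "\<mu> \<in> eigenvalues A" for \<mu>
    using that someI_ex[of "\<lambda>v. v \<noteq> 0 \<and> A *v v = \<mu> *\<^sub>R v"]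
    unfolding eigenvalues_def f_def by auto
  have orth: "orthogonal (f \<mu>) (f \<nu>)"
    if "\<mu> \<in> eigenvalues A" "\<nu> \<in> eigenvalues A" "\<mu> \<noteq> \<nu>" for \<mu> \<nu>
  proof -
    have "\<mu> * (f \<mu> \<bullet> f \<nu>) = (A *v f \<mu>) \<bullet> f \<nu>"
      using f[OF that(1)] by simp
    also have "\<dots> = f \<mu> \<bullet> (A *v f \<nu>)"
      using assms by (metis dot_lmul_matrix transpose_matrix_vector)
    also have "\<dots> = \<nu> * (f \<mu> \<bullet> f \<nu>)"
      using f[OF that(2)] by simp
    finally show ?thesis
      using that(3) by (simp add: orthogonal_def)
  qed
  have "inj_on f (eigenvalues A)"
    using orth f by (metis inj_onI orthogonal_self)
  moreover have "independent (f ` eigenvalues A)"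
  proof (rule pairwise_orthogonal_independent)
    show "pairwise orthogonal (f ` eigenvalues A)"
      using orth by (auto simp: pairwise_def)
    show "0 \<notin> f ` eigenvalues A"
      using f by (metis imageE)
  qed
  ultimately show ?thesis
    using independent_bound finite_imageD by blast
qed

end

theory Submission
  imports Defs
begin

text \<open>Every rank is an integer and the trimming thresholds are half-integers, so a rank estimate
  that is off by less than \<open>1/2\<close> already gives the exact weight. The centred indicator
  \<open>\<I>{X\<^sub>k > Y\<^sub>k(s)}\<close> is a linear functional \<open>f \<bullet> H(s)\<close> of the swapped 0/1 vector \<open>H(s)\<close>.
  Solving the Poisson equation \<open>L u = f\<close> for the graph Laplacian \<open>L\<close> turns its partial sums, up to
  the bounded term \<open>u \<bullet> H(t)\<close>, into a martingale with bounded increments. An exponential moment bound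
  then shows that a wrong weight at time \<open>s\<close> has probability exponentially small in \<open>s\<close>.
  If all weights are exact from time \<open>t/2\<close> on, nothing is injected any more and averaging contracts
  the deviation from the mean geometrically by the spectral gap. So the expected error decays
  exponentially, while the claimed bound is of order \<open>1/\<surd>t\<close> with a factor that does not vanish;
  since \<open>T\<close> may depend on the graph and on \<open>X\<close>, \<open>C\<^sub>0 = 1\<close> works.\<close>

section \<open>The Laplacian of a connected graph\<close>

text \<open>The same edges drive swapping and averaging, so the weights and the averaging matrices
  are dependent. The split at \<open>t div 2\<close> decouples them: the sum at that time depends on
  earlier edges only, the averaging product after it on later edges only, and nothing else
  contributes while all later rank estimates stay within 1/2 of the ranks. On the exceptional event
  the error is at most a multiple of t + 1, which the exponentially small probability absorbs. The
  Poisson equation is solvable because f = e_k - (1/n) 1 is orthogonal to \<open>1\<close> and, by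
  connectedness, the range of L is the whole orthogonal complement of \<open>1\<close>. The limits
  are the right ones because averaging preserves coordinate sums: under exact weights N has mean
  xbar and M has mean 1, a fixed point of \<open>max 1\<close>. The right-hand side must be shown to
  be positive. \<open>K_vec\<close> vanishes at the node of rank 1, and X + |xbar| 1 may vanish at
  one further node; non-bipartiteness forces n \<ge> 3, and then a node of rank 2 or 3 survives. The
  second eigenvalues contribute c > 0 and lam2 = 1 - c/2; the decay rates come from a compactness
  argument.\<close>

lemma outer_self_mult: "outer_self d *v v = (d \<bullet> v) *\<^sub>R d" for d v :: "real^'n"
  by (simp add: vec_eq_iff outer_self_def matrix_matrix_mult_def columnvector_def rowvector_def
      matrix_vector_mult_def inner_vec_def sum_distrib_left sum_distrib_right mult_ac)

lemma matrix_vector_mult_sum_left: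
  "(\<Sum>e\<in>S. A e) *v v = (\<Sum>e\<in>S. A e *v v)" for A :: "'b \<Rightarrow> real^'n^'m"
  by (induction S rule: infinite_finite_induct) (auto simp: matrix_vector_mult_add_rdistrib)

lemma matrix_vector_mult_scaleR_left: "(c *\<^sub>R A) *v v = c *\<^sub>R (A *v v)" for A :: "real^'n^'m"
  by (simp add: scaleR_matrix_vector_assoc)

lemma inner_one_vec: "1 \<bullet> v = (\<Sum>k\<in>UNIV. v $ k)" for v :: "real^'n"
  by (simp add: inner_vec_def)

locale gossip_graph =
  fixes E :: "'n::finite set set"
  assumes undirected: "undirected_graph E" and connected: "connected_graph E"
    and card_ge_2: "CARD('n) \<ge> 2"
begin

lemma edgeE:
  assumes "e \<in> E"
  obtains i j where "i \<noteq> j" "e = {i, j}"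
    "\<And>v. edge_laplacian e *v v = (v $ i - v $ j) *\<^sub>R (axis i 1 - axis j 1)"
proof -
  obtain i j where ij: "i \<noteq> j" "e = {i, j}"
    using assms undirected by (auto simp: undirected_graph_def)
  moreover have "edge_laplacian e *v v = (v $ i - v $ j) *\<^sub>R (axis i 1 - axis j 1)" for v
    unfolding ij(2) edge_laplacian_eq[OF ij(1)] outer_self_mult
    by (simp add: inner_diff_left inner_axis')
  ultimately show thesis using that by blast
qed

text \<open>The vector is the difference of the two endpoint axes; most later algebra uses only
  these three facts and never the endpoints. As its squared length is 2, \<open>avg_matrix e\<close>
  is the orthogonal projection along it and \<open>swap_matrix e\<close> the reflection.\<close>

lemma edge_directionE:
  assumes "e \<in> E"
  obtains d where "\<And>v. edge_laplacian e *v v = (d \<bullet> v) *\<^sub>R d" "d \<bullet> d = 2" "d \<bullet> 1 = 0"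
proof -
  obtain i j where ij: "i \<noteq> j" "e = {i, j}"
    "\<And>v. edge_laplacian e *v v = (v $ i - v $ j) *\<^sub>R (axis i 1 - axis j 1)"
    using edgeE[OF assms] by blast
  show thesis
  proof (rule that[of "axis i 1 - axis j 1"])
    show "(axis i 1 - axis j 1 :: real^'n) \<bullet> (axis i 1 - axis j 1) = 2"
      using ij(1) by (simp add: inner_diff_left inner_diff_right inner_axis_axis)
    show "(axis i 1 - axis j 1 :: real^'n) \<bullet> 1 = 0"
      by (simp add: inner_diff_left inner_axis')
    show "edge_laplacian e *v v = ((axis i 1 - axis j 1) \<bullet> v) *\<^sub>R (axis i 1 - axis j 1)" for v
      unfolding ij(3) by (simp add: inner_diff_left inner_axis')
  qed
qed

lemma avg_matrix_mult: "avg_matrix e *v v = v - (1/2) *\<^sub>R (edge_laplacian e *v v)" for v :: "real^'n"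
  by (simp add: avg_matrix_def matrix_vector_mult_diff_rdistrib matrix_vector_mult_scaleR_left)

lemma swap_matrix_mult: "swap_matrix e *v v = v - edge_laplacian e *v v" for v :: "real^'n"
  by (simp add: swap_matrix_def matrix_vector_mult_diff_rdistrib)

lemma norm_avg_matrix_mult:
  assumes "e \<in> E"
  shows "(norm (avg_matrix e *v v))\<^sup>2 = (norm v)\<^sup>2 - 1/2 * (v \<bullet> (edge_laplacian e *v v))"
proof -
  obtain d where d: "edge_laplacian e *v v = (d \<bullet> v) *\<^sub>R d" "d \<bullet> d = 2"
    using edge_directionE[OF assms] by metis
  show ?thesis
    unfolding power2_norm_eq_inner avg_matrix_mult d
    by (simp add: inner_diff_left inner_diff_right d inner_commute algebra_simps)
qed

lemma edge_laplacian_psd: "e \<in> E \<Longrightarrow> v \<bullet> (edge_laplacian e *v v) \<ge> 0"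
  by (erule edge_directionE) (simp add: inner_commute)

lemma norm_avg_matrix_le: "e \<in> E \<Longrightarrow> norm (avg_matrix e *v v) \<le> norm v"
  using norm_avg_matrix_mult[of e v] edge_laplacian_psd[of e v]
  by - (rule power2_le_imp_le, auto)

lemma avg_matrix_inner_one: "e \<in> E \<Longrightarrow> 1 \<bullet> (avg_matrix e *v v) = 1 \<bullet> v"
  by (erule edge_directionE) (simp add: avg_matrix_mult inner_diff_right inner_commute)

lemma avg_matrix_one: "e \<in> E \<Longrightarrow> avg_matrix e *v 1 = 1"
  by (erule edge_directionE) (simp add: avg_matrix_mult)

lemma norm_swap_matrix_mult:
  assumes "e \<in> E"
  shows "norm (swap_matrix e *v v) = norm v"
proof -
  obtain d where d: "edge_laplacian e *v v = (d \<bullet> v) *\<^sub>R d" "d \<bullet> d = 2"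
    using edge_directionE[OF assms] by metis
  show ?thesis
    unfolding norm_eq_sqrt_inner swap_matrix_mult d
    by (simp add: inner_diff_left inner_diff_right d inner_commute algebra_simps)
qed

text \<open>The permutation is the transposition of the endpoints. It is the same for all vectors,
  so a swap commutes with entrywise functions.\<close>

lemma swap_matrix_nth:
  assumes "e \<in> E"
  obtains \<pi> where "\<And>v::real^'n. swap_matrix e *v v = (\<chi> l. v $ \<pi> l)"
proof -
  obtain i j where ij: "i \<noteq> j" "e = {i, j}"
    "\<And>v. edge_laplacian e *v v = (v $ i - v $ j) *\<^sub>R (axis i 1 - axis j 1)"
    using edgeE[OF assms] by blast
  show thesis
    by (rule that[of "Transposition.transpose i j"])
      (use ij(1) in \<open>auto simp: swap_matrix_mult ij(3) vec_eq_iff axis_def Transposition.transpose_def\<close>)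
qed

section \<open>The quadratic form of the weighted Laplacian, its spectral gap and its range\<close>

lemma graph_laplacian_mult:
  "graph_laplacian E *v v = (\<Sum>e\<in>E. edge_prob E e *\<^sub>R (edge_laplacian e *v v))"
  by (simp add: graph_laplacian_def matrix_vector_mult_sum_left matrix_vector_mult_scaleR_left)

lemma edge_laplacian_self_adjoint:
  "e \<in> E \<Longrightarrow> v \<bullet> (edge_laplacian e *v w) = (edge_laplacian e *v v) \<bullet> w"
  by (erule edge_directionE) (simp add: inner_commute)

lemma graph_laplacian_self_adjoint:
  "v \<bullet> (graph_laplacian E *v w) = (graph_laplacian E *v v) \<bullet> w"
  by (simp add: graph_laplacian_mult inner_sum_left inner_sum_right edge_laplacian_self_adjoint)

lemma graph_laplacian_one: "graph_laplacian E *v 1 = 0"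
  unfolding graph_laplacian_mult
  by (intro sum.neutral ballI) (erule edge_directionE, simp)

lemma graph_laplacian_psd: "v \<bullet> (graph_laplacian E *v v) \<ge> 0"
  by (simp add: graph_laplacian_mult inner_sum_right sum_nonneg edge_prob_nonneg edge_laplacian_psd)

lemma edge_prob_pos:
  assumes "e \<in> E"
  shows "edge_prob E e > 0"
proof -
  obtain i j where "e = {i, j}" using edgeE[OF assms] by metis
  then have "e \<noteq> {}" by simp
  then have "(\<Sum>i\<in>e. 1 / real (node_degree E i)) > 0"
    by (intro sum_pos) (auto simp: node_degree_pos[OF connected card_ge_2])
  then show ?thesis by (simp add: edge_prob_def)
qed

text \<open>The form is a sum of nonnegative edge terms with positive probabilities. All of them
  vanish, so \<open>v\<close> is constant along edges, hence along paths.\<close>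

lemma graph_laplacian_form_zero:
  assumes "v \<bullet> (graph_laplacian E *v v) = 0"
  shows "v $ i = v $ j"
proof -
  have "(\<Sum>e\<in>E. edge_prob E e * (v \<bullet> (edge_laplacian e *v v))) = 0"
    using assms by (simp add: graph_laplacian_mult inner_sum_right)
  then have "\<forall>e\<in>E. edge_prob E e * (v \<bullet> (edge_laplacian e *v v)) = 0"
    by (subst (asm) sum_nonneg_eq_0_iff) (simp_all add: edge_prob_nonneg edge_laplacian_psd)
  then have zero: "v \<bullet> (edge_laplacian e *v v) = 0" if "e \<in> E" for e
    using edge_prob_pos[OF that] that by auto
  have edge: "v $ k = v $ l" if kl: "{k, l} \<in> E" for k l
  proof -
    obtain i j where ij: "i \<noteq> j" "{k, l} = {i, j}"
      "\<And>v. edge_laplacian {k, l} *v v = (v $ i - v $ j) *\<^sub>R (axis i 1 - axis j 1)"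
      using edgeE[OF kl] by blast
    from zero[OF kl] have "v $ i = v $ j"
      unfolding ij(3) by (simp add: inner_diff_right inner_axis)
    with ij(2) show ?thesis by (auto simp: doubleton_eq_iff)
  qed
  have "(i, j) \<in> {(k, l). {k, l} \<in> E}\<^sup>*"
    using connected by (auto simp: connected_graph_def)
  then show ?thesis by (induction rule: rtrancl_induct) (simp_all add: edge)
qed

text \<open>The form attains its minimum on the compact unit sphere of the hyperplane orthogonal to
  \<open>1\<close>, where it is positive; homogeneity does the rest.\<close>

lemma spectral_gap:
  obtains g where "g > 0" "\<And>v. 1 \<bullet> v = 0 \<Longrightarrow> v \<bullet> (graph_laplacian E *v v) \<ge> g * (norm v)\<^sup>2"
proof -
  define S where "S = {v :: real^'n. norm v = 1 \<and> 1 \<bullet> v = 0}"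
  have "S = sphere 0 1 \<inter> {v. 1 \<bullet> v = 0}" by (auto simp: S_def)
  then have "compact S" by (simp add: compact_Int_closed closed_hyperplane)
  have cont: "continuous_on S (\<lambda>v. v \<bullet> (graph_laplacian E *v v))"
    by (intro continuous_on_inner continuous_on_id matrix_vector_mult_linear_continuous_on)
  have pos: "v \<bullet> (graph_laplacian E *v v) > 0" if "v \<in> S" for v
  proof (rule ccontr)
    assume "\<not> ?thesis"
    then have "v \<bullet> (graph_laplacian E *v v) = 0"
      using graph_laplacian_psd[of v] by linarith
    then have "v $ i = v $ undefined" for i by (rule graph_laplacian_form_zero)
    then have "v = (v $ undefined) *\<^sub>R 1" unfolding vec_eq_iff by simp
    then obtain c where "v = c *\<^sub>R 1" by blast
    then show False using that by (auto simp: S_def inner_one_vec)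
  qed
  obtain g where g: "g > 0" "\<And>v. v \<in> S \<Longrightarrow> v \<bullet> (graph_laplacian E *v v) \<ge> g"
  proof (cases "S = {}")
    case False
    obtain x where "x \<in> S" "\<forall>v\<in>S. x \<bullet> (graph_laplacian E *v x) \<le> v \<bullet> (graph_laplacian E *v v)"
      using continuous_attains_inf[OF \<open>compact S\<close> False cont] by blast
    then show thesis using pos[of x] that[of "x \<bullet> (graph_laplacian E *v x)"] by blast
  qed (use that[of 1] in simp)
  show thesis
  proof (rule that[OF g(1)])
    fix v :: "real^'n" assume v: "1 \<bullet> v = 0"
    show "v \<bullet> (graph_laplacian E *v v) \<ge> g * (norm v)\<^sup>2"
    proof (cases "v = 0")
      case False
      then have "(1 / norm v) *\<^sub>R v \<in> S" using v by (simp add: S_def)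
      from g(2)[OF this] show ?thesis using False
        by (simp add: matrix_vector_mult_scaleR divide_simps power2_eq_square)
    qed simp
  qed
qed

text \<open>Adding the rank-one map \<open>(1 \<bullet> v) *\<^sub>R 1\<close> makes the Laplacian
  injective, hence surjective. A preimage \<open>u\<close> of a vector orthogonal to
  \<open>1\<close> is itself orthogonal to \<open>1\<close>, so the added term vanishes at
  \<open>u\<close>.\<close>

lemma graph_laplacian_range:
  assumes "1 \<bullet> f = 0"
  obtains u where "graph_laplacian E *v u = f"
proof -
  define T where "T v = graph_laplacian E *v v + (1 \<bullet> v) *\<^sub>R 1" for v :: "real^'n"
  have one_T: "1 \<bullet> T v = real CARD('n) * (1 \<bullet> v)" for v
    by (simp add: T_def inner_add_right graph_laplacian_self_adjoint graph_laplacian_one)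
      (simp add: inner_one_vec)
  have lin: "linear T"
    unfolding T_def
    by (intro linearI) (auto simp: matrix_vector_right_distrib inner_add_right matrix_vector_mult_scaleR algebra_simps)
  have "inj T"
  proof (subst linear_injective_0[OF lin], intro allI impI)
    fix v assume Tv: "T v = 0"
    then have "1 \<bullet> v = 0" using one_T[of v] by simp
    moreover obtain g where "g > 0" "\<And>v. 1 \<bullet> v = 0 \<Longrightarrow> v \<bullet> (graph_laplacian E *v v) \<ge> g * (norm v)\<^sup>2"
      using spectral_gap by metis
    ultimately have "g * (norm v)\<^sup>2 \<le> v \<bullet> T v" "g > 0" by (auto simp: T_def)
    then show "v = 0" using Tv by (simp add: mult_le_0_iff)
  qed
  then obtain u where u: "T u = f"
    using linear_injective_imp_surjective[OF lin] by (metis surj_def)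
  with one_T[of u] assms have "1 \<bullet> u = 0" by simp
  with u that[of u] show thesis by (simp add: T_def)
qed

end

section \<open>Second eigenvalues\<close>

text \<open>A zero of a positive semidefinite form minimises it. Moving from \<open>x\<close> along
  \<open>A *v x\<close> would make the form negative unless that direction is 0.\<close>

lemma psd_form_zero:
  fixes A :: "real^'n^'n"
  assumes sym: "\<And>v w. v \<bullet> (A *v w) = (A *v v) \<bullet> w" and psd: "\<And>v. v \<bullet> (A *v v) \<ge> 0"
    and zero: "x \<bullet> (A *v x) = 0"
  shows "A *v x = 0"
proof -
  define w where "w = A *v x"
  define q where "q = w \<bullet> (A *v w)"
  have q: "q \<ge> 0" by (simp add: q_def psd)
  \<comment> \<open>The quadratic in \<open>r\<close> has its minimum at -(w . w)/q. The denominator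
    q + 1 also covers q = 0 and still gives a negative value unless w = 0.\<close>
  define r where "r = - (w \<bullet> w) / (q + 1)"
  have "0 \<le> (x + r *\<^sub>R w) \<bullet> (A *v (x + r *\<^sub>R w))" by (rule psd)
  also have "\<dots> = 2 * r * (w \<bullet> w) + r\<^sup>2 * q"
    using sym[of x w] zero
    by (simp add: matrix_vector_right_distrib matrix_vector_mult_scaleR inner_add_left inner_add_right
        q_def power2_eq_square distrib_left mult.assoc flip: w_def)
  finally have "0 \<le> (2 * r * (w \<bullet> w) + r\<^sup>2 * q) * (q + 1)\<^sup>2" by simp
  also have "\<dots> = 2 * (r * (q + 1)) * (q + 1) * (w \<bullet> w) + (r * (q + 1))\<^sup>2 * q"
    by (simp add: power2_eq_square algebra_simps)
  also have "r * (q + 1) = - (w \<bullet> w)" using q by (simp add: r_def)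
  finally have "(w \<bullet> w)\<^sup>2 * (q + 2) \<le> 0" by (simp add: power2_eq_square algebra_simps)
  then have "w \<bullet> w = 0" using q by (simp add: mult_le_0_iff)
  then show ?thesis by (simp add: w_def)
qed

lemma count_eigenvalue_mset:
  assumes "transpose A = A"
  shows "count (eigenvalue_mset A) \<mu> = (if \<mu> \<in> eigenvalues A then dim (eigenspace A \<mu>) else 0)"
  using finite_eigenvalues[OF assms] by (simp add: eigenvalue_mset_def count_sum)

lemma set_eigenvalue_mset:
  assumes "transpose A = A"
  shows "set_mset (eigenvalue_mset A) = eigenvalues A"
proof -
  have "dim (eigenspace A \<mu>) > 0" if "\<mu> \<in> eigenvalues A" for \<mu>
    using that by (subst neq0_conv[symmetric], subst dim_eq_0) (auto simp: eigenvalues_def eigenspace_def)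
  then show ?thesis
    by (auto simp: set_mset_def count_eigenvalue_mset[OF assms])
qed

lemma image_mset_sum: "image_mset f (\<Sum>x\<in>S. g x) = (\<Sum>x\<in>S. image_mset f (g x))"
  by (induction S rule: infinite_finite_induct) auto

lemma eigenvalue_mset_affine:
  fixes A :: "real^'n^'n"
  assumes "transpose A = A" "c \<noteq> 0"
  shows "eigenvalue_mset (mat 1 - c *\<^sub>R A) = image_mset (\<lambda>\<mu>. 1 - c * \<mu>) (eigenvalue_mset A)"
proof -
  have iff: "(mat 1 - c *\<^sub>R A) *v v = (1 - c * \<mu>) *\<^sub>R v \<longleftrightarrow> A *v v = \<mu> *\<^sub>R v" for v :: "real^'n" and \<mu>
  proof -
    have "(mat 1 - c *\<^sub>R A) *v v - (1 - c * \<mu>) *\<^sub>R v = - c *\<^sub>R (A *v v - \<mu> *\<^sub>R v)"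
      by (simp add: matrix_vector_mult_diff_rdistrib matrix_vector_mult_scaleR_left algebra_simps)
    then show ?thesis using \<open>c \<noteq> 0\<close>
      by (metis eq_iff_diff_eq_0 neg_equal_0_iff_equal scaleR_eq_0_iff)
  qed
  have surj: "\<exists>\<mu>. \<nu> = 1 - c * \<mu>" for \<nu> using \<open>c \<noteq> 0\<close> by (intro exI[of _ "(1 - \<nu>) / c"]) simp
  have ev: "eigenvalues (mat 1 - c *\<^sub>R A) = (\<lambda>\<mu>. 1 - c * \<mu>) ` eigenvalues A"
  proof (intro set_eqI iffI)
    fix \<nu> assume *: "\<nu> \<in> eigenvalues (mat 1 - c *\<^sub>R A)"
    obtain \<mu> where "\<nu> = 1 - c * \<mu>" using surj by blast
    with * show "\<nu> \<in> (\<lambda>\<mu>. 1 - c * \<mu>) ` eigenvalues A" by (auto simp: eigenvalues_def iff)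
  qed (auto simp: eigenvalues_def iff)
  have es: "eigenspace (mat 1 - c *\<^sub>R A) (1 - c * \<mu>) = eigenspace A \<mu>" for \<mu>
    by (simp add: eigenspace_def iff)
  have inj: "inj_on (\<lambda>\<mu>. 1 - c * \<mu>) (eigenvalues A)" using \<open>c \<noteq> 0\<close> by (simp add: inj_on_def)
  show ?thesis
    by (simp add: eigenvalue_mset_def ev sum.reindex[OF inj] es image_mset_sum)
qed

text \<open>Applied to \<mu> -> 1 - \<mu>/2, this carries the second smallest eigenvalue of the
  Laplacian to the second largest of the mean averaging matrix, multiplicities included.\<close>

lemma rev_sorted_list_image_antimono:
  fixes f :: "real \<Rightarrow> real"
  assumes "antimono f"
  shows "rev (sorted_list_of_multiset (image_mset f M)) = map f (sorted_list_of_multiset M)"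
proof -
  define xs where "xs = sorted_list_of_multiset M"
  have "sorted xs" by (simp add: xs_def)
  then have "sorted (rev (map f xs))"
    by (induction xs) (auto simp: sorted_append intro: antimonoD[OF assms])
  then have "sort (rev (map f xs)) = rev (map f xs)" by (rule sorted_sort_id)
  moreover have "image_mset f M = mset (rev (map f xs))" by (simp add: xs_def)
  ultimately have "sorted_list_of_multiset (image_mset f M) = rev (map f xs)"
    by (metis sorted_list_of_multiset_mset)
  then show ?thesis by (simp add: xs_def)
qed

context gossip_graph
begin

lemma transpose_graph_laplacian: "transpose (graph_laplacian E) = graph_laplacian E"
proof -
  have "v \<bullet> (transpose (graph_laplacian E) *v w) = v \<bullet> (graph_laplacian E *v w)" for v w
    by (metis dot_lmul_matrix graph_laplacian_self_adjoint inner_commute transpose_matrix_vector)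
  then have "transpose (graph_laplacian E) *v w = graph_laplacian E *v w" for w
    using vector_eq_ldot by blast
  then show ?thesis unfolding matrix_eq by blast
qed

lemma graph_laplacian_kernel: "eigenspace (graph_laplacian E) 0 = span {1}"
proof (intro set_eqI iffI)
  fix v assume "v \<in> eigenspace (graph_laplacian E) 0"
  then have "v \<bullet> (graph_laplacian E *v v) = 0" by (simp add: eigenspace_def)
  then have "v $ i = v $ undefined" for i by (rule graph_laplacian_form_zero)
  then have "v = (v $ undefined) *\<^sub>R 1" unfolding vec_eq_iff by simp
  then show "v \<in> span {1}" by (auto simp: span_singleton)
next
  fix v :: "real^'n" assume "v \<in> span {1}"
  then show "v \<in> eigenspace (graph_laplacian E) 0"
    by (auto simp: span_singleton eigenspace_def matrix_vector_mult_scaleR graph_laplacian_one)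
qed

text \<open>Together with 0 this gives the sorted eigenvalue list at least two entries, so that
  \<open>! 1\<close> reads an actual eigenvalue. The witness is the maximum of the Rayleigh
  quotient.\<close>

lemma graph_laplacian_pos_eigenvalue:
  obtains \<mu> where "\<mu> > 0" "\<mu> \<in> eigenvalues (graph_laplacian E)"
proof -
  let ?L = "graph_laplacian E"
  have cont: "continuous_on (sphere 0 1) (\<lambda>v. v \<bullet> (?L *v v))"
    by (intro continuous_on_inner continuous_on_id matrix_vector_mult_linear_continuous_on)
  obtain x where x: "norm x = 1" and max: "\<And>v. norm v = 1 \<Longrightarrow> v \<bullet> (?L *v v) \<le> x \<bullet> (?L *v x)"
    using continuous_attains_sup[OF compact_sphere _ cont] by auto
  define \<mu> where "\<mu> = x \<bullet> (?L *v x)"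
  have le: "v \<bullet> (?L *v v) \<le> \<mu> * (v \<bullet> v)" for v
  proof (cases "v = 0")
    case False
    then show ?thesis using max[of "(1 / norm v) *\<^sub>R v"]
      by (simp add: matrix_vector_mult_scaleR divide_simps \<mu>_def dot_square_norm power2_eq_square)
  qed simp
  \<comment> \<open>Maximality of \<mu> says that \<mu> I - L is positive semidefinite with
    vanishing form at \<open>x\<close>, so \<open>x\<close> lies in its kernel.\<close>
  define B where "B = \<mu> *\<^sub>R mat 1 - ?L"
  have B: "B *v v = \<mu> *\<^sub>R v - ?L *v v" for v
    by (simp add: B_def matrix_vector_mult_diff_rdistrib matrix_vector_mult_scaleR_left)
  have "B *v x = 0"
  proof (rule psd_form_zero)
    show "v \<bullet> (B *v w) = (B *v v) \<bullet> w" for v w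
      using graph_laplacian_self_adjoint[of v w] by (simp add: B inner_diff_left inner_diff_right)
    show "v \<bullet> (B *v v) \<ge> 0" for v using le[of v] by (simp add: B inner_diff_right)
    show "x \<bullet> (B *v x) = 0" using x by (simp add: B inner_diff_right dot_square_norm \<mu>_def)
  qed
  then have "?L *v x = \<mu> *\<^sub>R x" by (simp add: B)
  moreover have "x \<noteq> 0" using x by auto
  ultimately have "\<mu> \<in> eigenvalues ?L" by (auto simp: eigenvalues_def)
  moreover have "\<mu> > 0"
  proof (rule ccontr)
    assume "\<not> \<mu> > 0"
    moreover fix k :: 'n
    have "axis k 1 \<bullet> (?L *v axis k 1) \<le> \<mu>" using le[of "axis k 1"] by (simp add: inner_axis_axis)
    ultimately have "axis k 1 \<bullet> (?L *v axis k 1) = 0"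
      using graph_laplacian_psd[of "axis k 1"] by linarith
    then have const: "axis k (1::real) $ i = axis k 1 $ j" for i j
      by (rule graph_laplacian_form_zero)
    have "i = k" for i using const[of i k] by (simp add: axis_def split: if_splits)
    then have "UNIV = {k}" by blast
    from arg_cong[OF this, of card] show False using card_ge_2 by simp
  qed
  ultimately show thesis using that by blast
qed

text \<open>All entries of the sorted list are nonnegative and 0 occurs exactly once, the kernel
  being spanned by \<open>1\<close>; the entry of index 1 is therefore positive.\<close>

lemma
  shows second_smallest_eigenvalue_pos: "second_smallest_eigenvalue (graph_laplacian E) > 0"
    and second_largest_eigenvalue_mean_avg:
      "second_largest_eigenvalue (mean_avg_matrix E) =
        1 - second_smallest_eigenvalue (graph_laplacian E) / 2"
proof -
  let ?M = "eigenvalue_mset (graph_laplacian E)"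
  define xs where "xs = sorted_list_of_multiset ?M"
  obtain \<mu> where \<mu>: "\<mu> > 0" "\<mu> \<in> eigenvalues (graph_laplacian E)"
    by (rule graph_laplacian_pos_eigenvalue)
  have set_xs: "set xs = eigenvalues (graph_laplacian E)"
    by (simp add: xs_def set_eigenvalue_mset transpose_graph_laplacian)
  have zero: "0 \<in> eigenvalues (graph_laplacian E)"
    by (auto simp: eigenvalues_def graph_laplacian_one intro!: exI[of _ 1])
  have nonneg: "\<nu> \<ge> 0" if "\<nu> \<in> eigenvalues (graph_laplacian E)" for \<nu>
  proof -
    obtain v where v: "v \<noteq> 0" "graph_laplacian E *v v = \<nu> *\<^sub>R v"
      using \<open>\<nu> \<in> _\<close> by (auto simp: eigenvalues_def)
    have "v \<bullet> v > 0" using v(1) by simp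
    moreover have "0 \<le> \<nu> * (v \<bullet> v)" using graph_laplacian_psd[of v] v(2) by simp
    ultimately show ?thesis by (metis mult_neg_pos not_le)
  qed
  have "count_list xs 0 = count (mset xs) 0" by (simp add: count_mset)
  also have "\<dots> = 1"
    using zero
    by (simp add: xs_def count_eigenvalue_mset transpose_graph_laplacian graph_laplacian_kernel)
  finally have count: "count_list xs 0 = 1" .
  have "{0, \<mu>} \<subseteq> set xs" using set_xs zero \<mu> by auto
  then obtain a b ys where xs: "xs = a # b # ys"
    using \<mu>(1) by (cases xs; cases "tl xs") auto
  have "sorted xs" by (simp add: xs_def)
  then have "a \<le> b" by (simp add: xs)
  moreover have "a \<ge> 0" "b \<ge> 0" using nonneg[of a] nonneg[of b] by (simp_all add: xs flip: set_xs)
  moreover have "\<not> (a = 0 \<and> b = 0)" using count by (auto simp: xs)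
  ultimately have "b > 0" by linarith
  moreover have b: "second_smallest_eigenvalue (graph_laplacian E) = b"
    using xs by (simp add: second_smallest_eigenvalue_def xs_def)
  ultimately show "second_smallest_eigenvalue (graph_laplacian E) > 0" by simp
  have "eigenvalue_mset (mean_avg_matrix E) = image_mset (\<lambda>\<mu>. 1 - 1/2 * \<mu>) ?M"
    unfolding mean_avg_matrix_def by (intro eigenvalue_mset_affine transpose_graph_laplacian) simp
  moreover have "antimono (\<lambda>\<mu>::real. 1 - 1/2 * \<mu>)" by (simp add: antimono_def)
  ultimately have "rev (sorted_list_of_multiset (eigenvalue_mset (mean_avg_matrix E))) =
      map (\<lambda>\<mu>. 1 - 1/2 * \<mu>) xs"
    by (simp add: rev_sorted_list_image_antimono xs_def)
  then show "second_largest_eigenvalue (mean_avg_matrix E) =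
      1 - second_smallest_eigenvalue (graph_laplacian E) / 2"
    using xs b by (simp add: second_largest_eigenvalue_def)
qed

end

section \<open>Expectations over the edge sequence\<close>

text \<open>Dependence on finitely many edges gives measurability and boundedness at once, the set of
  edges being finite.\<close>

definition prefix_dependent :: "nat \<Rightarrow> ((nat \<Rightarrow> 'a) \<Rightarrow> 'b) \<Rightarrow> bool" where
  "prefix_dependent t F \<longleftrightarrow> (\<forall>\<xi> \<xi>'. (\<forall>i\<le>t. \<xi> i = \<xi>' i) \<longrightarrow> F \<xi> = F \<xi>')"

lemma prefix_dependentD:
  "prefix_dependent t F \<Longrightarrow> (\<And>i. i \<le> t \<Longrightarrow> \<xi> i = \<xi>' i) \<Longrightarrow> F \<xi> = F \<xi>'"
  by (simp add: prefix_dependent_def)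

lemma prefix_dependent_mono: "prefix_dependent s F \<Longrightarrow> s \<le> t \<Longrightarrow> prefix_dependent t F"
  unfolding prefix_dependent_def by (meson order_trans)

lemma prefix_dependent_const: "prefix_dependent t (\<lambda>_. c)"
  by (simp add: prefix_dependent_def)

lemma prefix_dependent_comp: "prefix_dependent t F \<Longrightarrow> prefix_dependent t (\<lambda>\<xi>. g (F \<xi>))"
  unfolding prefix_dependent_def by metis

lemma prefix_dependent_comp2:
  "prefix_dependent t F \<Longrightarrow> prefix_dependent t G \<Longrightarrow> prefix_dependent t (\<lambda>\<xi>. g (F \<xi>) (G \<xi>))"
  unfolding prefix_dependent_def by metis

lemma prefix_dependent_nth: "s \<le> t \<Longrightarrow> prefix_dependent t (\<lambda>\<xi>. g (\<xi> s))"
  unfolding prefix_dependent_def by simp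

lemma prefix_dependent_sum:
  "(\<And>i. i \<in> S \<Longrightarrow> prefix_dependent t (\<lambda>\<xi>. F i \<xi>)) \<Longrightarrow> prefix_dependent t (\<lambda>\<xi>. \<Sum>i\<in>S. F i \<xi>)"
  unfolding prefix_dependent_def by (intro allI impI sum.cong refl) blast

lemma prefix_dependent_upd: "prefix_dependent t F \<Longrightarrow> s > t \<Longrightarrow> F (\<xi>(s := e)) = F \<xi>"
  by (rule prefix_dependentD) auto

text \<open>Factors \<open>F\<close> through lists of length \<open>Suc t\<close> (coordinate 0
  included) over a finite type: there are finitely many such lists, which yields measurability and a
  finite range.\<close>

lemma prefix_dependent_list:
  assumes "prefix_dependent t F"
  shows "F \<xi> = F (\<lambda>i. map \<xi> [0..<Suc t] ! i)"
  by (rule prefix_dependentD[OF assms]) (simp del: upt_Suc)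

context gossip_graph
begin

lemma prob_space_edge_seq: "prob_space (edge_seq_measure E)"
  unfolding edge_seq_measure_def by (intro prob_space_PiM measure_pmf.prob_space_axioms)

lemma space_edge_seq: "space (edge_seq_measure E) = UNIV"
  by (simp add: edge_seq_measure_def space_PiM)

lemma set_edge_pmf: "set_pmf (edge_pmf E) \<subseteq> E"
  by (auto simp: set_pmf_iff pmf_edge_pmf[OF connected card_ge_2] split: if_splits)

lemma integral_edge_pmf: "(LINT e|measure_pmf (edge_pmf E). F e) = (\<Sum>e\<in>E. edge_prob E e * F e)"
  for F :: "'n set \<Rightarrow> real"
  using set_edge_pmf
  by (subst integral_measure_pmf[of E]) (auto simp: pmf_edge_pmf[OF connected card_ge_2])

text \<open>The product space also contains sequences that leave \<open>E\<close>, where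
  \<open>edge_laplacian\<close> need not have its rank-one form. Pathwise estimates are therefore
  made almost surely.\<close>

lemma AE_edges: "AE \<xi> in edge_seq_measure E. \<forall>s. \<xi> s \<in> E"
  unfolding AE_all_countable
proof
  show "AE \<xi> in edge_seq_measure E. \<xi> s \<in> E" for s
    unfolding edge_seq_measure_def
    by (rule AE_PiM_component[where P = "\<lambda>e. e \<in> E"])
      (use set_edge_pmf in \<open>auto simp: AE_measure_pmf_iff measure_pmf.prob_space_axioms\<close>)
qed

lemma measurable_prefix_dependent:
  fixes F :: "(nat \<Rightarrow> 'n set) \<Rightarrow> 'b::topological_space"
  assumes "prefix_dependent t F"
  shows "F \<in> borel_measurable (edge_seq_measure E)"
proof -
  let ?pre = "\<lambda>\<xi>::nat \<Rightarrow> 'n set. map \<xi> [0..<Suc t]"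
  have "?pre \<in> measurable (edge_seq_measure E) (count_space UNIV)"
  proof (subst measurable_count_space_eq2_countable, intro conjI ballI)
    fix l :: "'n set list"
    have comp: "(\<lambda>\<xi>. \<xi> i) \<in> measurable (edge_seq_measure E) (count_space UNIV)" for i
      using measurable_component_singleton[of i UNIV "\<lambda>_. measure_pmf (edge_pmf E)"]
      by (simp add: edge_seq_measure_def)
    have pre: "map \<xi> [0..<Suc t] = l \<longleftrightarrow> length l = Suc t \<and> (\<forall>i\<in>{..t}. \<xi> i = l ! i)" for \<xi>
      unfolding list_eq_iff_nth_eq by (auto simp: less_Suc_eq_le simp del: upt_Suc)
    have "?pre -` {l} \<inter> space (edge_seq_measure E) =
      (if length l = Suc t then {\<xi> \<in> space (edge_seq_measure E). \<forall>i\<in>{..t}. \<xi> i = l ! i} else {})"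
      by (simp add: vimage_def pre space_edge_seq del: upt_Suc)
    also have "\<dots> \<in> sets (edge_seq_measure E)"
    proof -
      have "{\<xi> \<in> space (edge_seq_measure E). \<xi> i = l ! i} \<in> sets (edge_seq_measure E)" for i
        using measurable_sets[OF comp, of "{l ! i}" i] by (simp add: vimage_def Int_def conj_commute)
      then show ?thesis by (auto intro!: sets.sets_Collect_finite_All)
    qed
    finally show "?pre -` {l} \<inter> space (edge_seq_measure E) \<in> sets (edge_seq_measure E)" .
  qed auto
  then have "(\<lambda>\<xi>. F (\<lambda>i. ?pre \<xi> ! i)) \<in> borel_measurable (edge_seq_measure E)"
    by (rule measurable_compose) simp
  also have "(\<lambda>\<xi>. F (\<lambda>i. ?pre \<xi> ! i)) = F"
    by (rule ext, rule prefix_dependent_list[OF assms, symmetric])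
  finally show ?thesis .
qed

lemma integrable_prefix_dependent:
  fixes F :: "(nat \<Rightarrow> 'n set) \<Rightarrow> real"
  assumes "prefix_dependent t F"
  shows "integrable (edge_seq_measure E) F"
proof -
  interpret prob_space "edge_seq_measure E" by (rule prob_space_edge_seq)
  have "range F \<subseteq> (\<lambda>l. F (\<lambda>i. l ! i)) ` {l. set l \<subseteq> UNIV \<and> length l = Suc t}"
  proof
    fix x assume "x \<in> range F"
    then obtain \<xi> where "x = F \<xi>" by blast
    then have "x = F (\<lambda>i. map \<xi> [0..<Suc t] ! i)"
      by (metis prefix_dependent_list[OF assms])
    then show "x \<in> (\<lambda>l. F (\<lambda>i. l ! i)) ` {l. set l \<subseteq> UNIV \<and> length l = Suc t}"
      by (rule image_eqI[of _ _ "map \<xi> [0..<Suc t]"]) (simp del: upt_Suc)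
  qed
  then have "finite (range F)"
    by (rule finite_subset) (intro finite_imageI finite_lists_length_eq, simp)
  then obtain B where "\<And>\<xi>. \<bar>F \<xi>\<bar> \<le> B"
    by (metis finite_imp_bounded bounded_iff rangeI real_norm_def)
  then show ?thesis
    by (intro integrable_const_bound[of _ B] measurable_prefix_dependent[OF assms]) auto
qed

text \<open>Replaces conditional expectations: if \<open>j\<close> is the last edge on which
  \<open>F\<close> depends, the inner sum is the conditional mean of \<open>F\<close> given the
  other edges.\<close>

lemma integral_resample:
  fixes F :: "(nat \<Rightarrow> 'n set) \<Rightarrow> real"
  assumes F: "prefix_dependent t F"
  shows "(LINT \<xi>|edge_seq_measure E. F \<xi>) =
    (LINT \<xi>|edge_seq_measure E. (\<Sum>e\<in>E. edge_prob E e * F (\<xi>(j := e))))"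
proof -
  let ?p = "measure_pmf (edge_pmf E)"
  define Q where "Q = Pi\<^sub>M (UNIV - {j}) (\<lambda>_::nat. ?p)"
  interpret Q: prob_space Q
    unfolding Q_def by (intro prob_space_PiM measure_pmf.prob_space_axioms)
  interpret pair_sigma_finite ?p Q ..
  have P: "edge_seq_measure E = distr (?p \<Otimes>\<^sub>M Q) (edge_seq_measure E) (\<lambda>(x, X). X(j := x))"
    using distr_pair_PiM_eq_PiM[of "UNIV - {j}" "\<lambda>_. ?p" j,
        OF measure_pmf.prob_space_axioms measure_pmf.prob_space_axioms]
    by (simp add: Q_def edge_seq_measure_def insert_absorb)
  have meas: "(\<lambda>(x, X). X(j := x)) \<in> measurable (?p \<Otimes>\<^sub>M Q) (edge_seq_measure E)"
    unfolding edge_seq_measure_def Q_def split_beta'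
    by (rule measurable_fun_upd[where J = "UNIV - {j}"]) auto
  have fubini: "(LINT \<xi>|edge_seq_measure E. G \<xi>) =
      (LINT X|Q. (\<Sum>e\<in>E. edge_prob E e * G (X(j := e))))"
    if G: "prefix_dependent s G" for s and G :: "(nat \<Rightarrow> 'n set) \<Rightarrow> real"
  proof -
    have "integrable (distr (?p \<Otimes>\<^sub>M Q) (edge_seq_measure E) (\<lambda>(x, X). X(j := x))) G"
      using integrable_prefix_dependent[OF G] P by simp
    then have int: "integrable (?p \<Otimes>\<^sub>M Q) (\<lambda>(x, X). G (X(j := x)))"
      by (subst (asm) integrable_distr_eq[OF meas measurable_prefix_dependent[OF G]])
        (simp add: split_beta')
    have "(LINT \<xi>|edge_seq_measure E. G \<xi>) = (LINT z|(?p \<Otimes>\<^sub>M Q). G (case z of (x, X) \<Rightarrow> X(j := x)))"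
      by (subst P) (rule integral_distr[OF meas measurable_prefix_dependent[OF G]])
    also have "\<dots> = (LINT z|(?p \<Otimes>\<^sub>M Q). (case z of (x, X) \<Rightarrow> G (X(j := x))))"
      by (simp add: split_beta')
    also have "\<dots> = (LINT X|Q. LINT x|?p. G (X(j := x)))"
      using integral_snd[OF int] by simp
    finally show ?thesis by (simp add: integral_edge_pmf)
  qed
  have "prefix_dependent (max t j) (\<lambda>\<xi>. \<Sum>e\<in>E. edge_prob E e * F (\<xi>(j := e)))"
    unfolding prefix_dependent_def
  proof (intro allI impI sum.cong refl, goal_cases)
    case (1 \<xi> \<xi>' e)
    then have "F (\<xi>(j := e)) = F (\<xi>'(j := e))" by (intro prefix_dependentD[OF F]) auto
    then show ?case by simp
  qed
  \<comment> \<open>The resampled function ignores coordinate \<open>j\<close>, so applying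
    \<open>fubini\<close> to it averages a constant with total mass 1 and leaves the same integral
    over \<open>Q\<close>.\<close>
  then show ?thesis
    by (simp add: fubini[OF F] fubini sum_edge_prob[OF connected card_ge_2] flip: sum_distrib_right)
qed

end

section \<open>Concentration of the rank estimates\<close>

lemma prefix_dependent_swapped_obs: "prefix_dependent t (\<lambda>\<xi>. swapped_obs X \<xi> t)"
proof (induction t)
  case (Suc t)
  have "prefix_dependent (Suc t) (\<lambda>\<xi>. swap_matrix (\<xi> (Suc t)) *v swapped_obs X \<xi> t)"
    by (rule prefix_dependent_comp2[where g = "(*v)", OF
          prefix_dependent_nth[OF order_refl] prefix_dependent_mono[OF Suc le_SucI[OF order_refl]]])
  then show ?case by simp
qed (simp add: prefix_dependent_const)

text \<open>For x = -y < 0 the bound follows from (1 - y + y^2)(1 + y) = 1 + y^3 \<ge> 1 and exp y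
  \<ge> 1 + y.\<close>

lemma exp_le_quadratic:
  fixes x :: real
  assumes "\<bar>x\<bar> \<le> 1"
  shows "exp x \<le> 1 + x + x\<^sup>2"
proof (cases "x \<ge> 0")
  case True
  then show ?thesis using assms by (intro exp_bound) auto
next
  case False
  define y where "y = - x"
  have y: "y > 0" using False by (simp add: y_def)
  have "1 \<le> 1 + y ^ 3" using y by simp
  also have "\<dots> = (1 - y + y\<^sup>2) * (1 + y)"
    by (simp add: algebra_simps power2_eq_square power3_eq_cube)
  also have "\<dots> \<le> (1 - y + y\<^sup>2) * exp y"
  proof (rule mult_left_mono)
    have "1 - y + y\<^sup>2 = (1 - y / 2)\<^sup>2 + 3 / 4 * y\<^sup>2" by (simp add: power2_eq_square algebra_simps)
    then show "0 \<le> 1 - y + y\<^sup>2" by simp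
  qed (rule exp_ge_add_one_self)
  finally have "exp (- y) \<le> 1 - y + y\<^sup>2" by (simp add: exp_minus field_simps)
  then show ?thesis by (simp add: y_def)
qed

context gossip_graph
begin

lemma norm_swapped_obs: "(\<And>s. \<xi> s \<in> E) \<Longrightarrow> norm (swapped_obs X \<xi> t) = norm X"
  by (induction t) (simp_all add: norm_swap_matrix_mult)

lemma swap_matrix_inner_one: "e \<in> E \<Longrightarrow> 1 \<bullet> (swap_matrix e *v v) = 1 \<bullet> v"
  by (erule edge_directionE) (simp add: swap_matrix_mult inner_diff_right inner_commute)

lemma swapped_obs_inner_one: "(\<And>s. \<xi> s \<in> E) \<Longrightarrow> 1 \<bullet> swapped_obs X \<xi> t = 1 \<bullet> X"
  by (induction t) (simp_all add: swap_matrix_inner_one)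

text \<open>This makes the threshold indicator linear: comparing with the swapped observations
  equals swapping the 0/1 vector of comparisons.\<close>

lemma swapped_obs_map:
  assumes "\<And>s. \<xi> s \<in> E"
  shows "swapped_obs (\<chi> l. f (X $ l)) \<xi> t = (\<chi> l. f (swapped_obs X \<xi> t $ l))"
proof (induction t)
  case (Suc t)
  obtain \<pi> where \<pi>: "\<And>v::real^'n. swap_matrix (\<xi> (Suc t)) *v v = (\<chi> l. v $ \<pi> l)"
    using swap_matrix_nth[OF assms] by blast
  show ?case by (simp add: Suc \<pi>)
qed simp

text \<open>The martingale increment attached to \<open>u\<close> when the current vector \<open>w\<close> is swapped along \<open>e\<close>.\<close>

definition swap_increment :: "real^'n \<Rightarrow> real^'n \<Rightarrow> 'n set \<Rightarrow> real" where
  "swap_increment u w e = (graph_laplacian E *v u) \<bullet> w - u \<bullet> (edge_laplacian e *v w)"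

text \<open>The second term has mean u . Lw, which self-adjointness identifies with the first term
  Lu . w.\<close>

lemma swap_increment_mean: "(\<Sum>e\<in>E. edge_prob E e * swap_increment u w e) = 0"
proof -
  have "(\<Sum>e\<in>E. edge_prob E e * swap_increment u w e) =
      (\<Sum>e\<in>E. edge_prob E e) * ((graph_laplacian E *v u) \<bullet> w) - u \<bullet> (graph_laplacian E *v w)"
    by (simp add: swap_increment_def graph_laplacian_mult[of w] inner_sum_right right_diff_distrib
        sum_subtractf sum_distrib_right)
  then show ?thesis
    by (simp add: sum_edge_prob[OF connected card_ge_2] graph_laplacian_self_adjoint)
qed

lemma swap_increment_bound:
  assumes "e \<in> E"
  shows "\<bar>swap_increment u w e\<bar> \<le> (norm (graph_laplacian E *v u) + 2 * norm u) * norm w"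
proof -
  obtain d where d: "edge_laplacian e *v w = (d \<bullet> w) *\<^sub>R d" "d \<bullet> d = 2"
    using edge_directionE[OF assms] by metis
  have "\<bar>u \<bullet> (edge_laplacian e *v w)\<bar> = \<bar>d \<bullet> w\<bar> * \<bar>u \<bullet> d\<bar>"
    by (simp add: d abs_mult)
  also have "\<dots> \<le> (norm d * norm w) * (norm u * norm d)"
    by (intro mult_mono Cauchy_Schwarz_ineq2) auto
  also have "\<dots> = 2 * norm u * norm w"
    using d(2) by (simp add: power2_norm_eq_inner[symmetric] power2_eq_square)
  finally have "\<bar>u \<bullet> (edge_laplacian e *v w)\<bar> \<le> 2 * norm u * norm w" .
  moreover have "\<bar>(graph_laplacian E *v u) \<bullet> w\<bar> \<le> norm (graph_laplacian E *v u) * norm w"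
    by (rule Cauchy_Schwarz_ineq2)
  ultimately show ?thesis unfolding swap_increment_def by (simp add: algebra_simps)
qed

text \<open>Expand exp to second order; the linear term has mean zero, and 1 + z \<le> exp z turns
  the remainder back into an exponential.\<close>

lemma swap_increment_mgf:
  assumes B: "(norm (graph_laplacian E *v u) + 2 * norm u) * norm w \<le> B"
    and \<theta>: "\<theta> \<ge> 0" "\<theta> * B \<le> 1"
  shows "(\<Sum>e\<in>E. edge_prob E e * exp (\<theta> * swap_increment u w e)) \<le> exp ((\<theta> * B)\<^sup>2)"
proof -
  have abs: "\<bar>\<theta> * swap_increment u w e\<bar> \<le> \<theta> * B" if "e \<in> E" for e
    using order_trans[OF swap_increment_bound[OF that, of u w] B] \<theta>(1)
    by (simp add: abs_mult mult_left_mono)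
  have "(\<Sum>e\<in>E. edge_prob E e * exp (\<theta> * swap_increment u w e)) \<le>
      (\<Sum>e\<in>E. edge_prob E e * (1 + \<theta> * swap_increment u w e + (\<theta> * B)\<^sup>2))"
  proof (intro sum_mono mult_left_mono edge_prob_nonneg)
    fix e assume e: "e \<in> E"
    have "exp (\<theta> * swap_increment u w e) \<le> 1 + \<theta> * swap_increment u w e + (\<theta> * swap_increment u w e)\<^sup>2"
      using abs[OF e] \<theta> by (intro exp_le_quadratic) simp
    moreover have "(\<theta> * swap_increment u w e)\<^sup>2 \<le> (\<theta> * B)\<^sup>2"
      using power_mono[OF abs[OF e], of 2] by simp
    ultimately show "exp (\<theta> * swap_increment u w e) \<le> 1 + \<theta> * swap_increment u w e + (\<theta> * B)\<^sup>2"
      by linarith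
  qed
  also have "\<dots> = (\<Sum>e\<in>E. edge_prob E e) * (1 + (\<theta> * B)\<^sup>2) +
      \<theta> * (\<Sum>e\<in>E. edge_prob E e * swap_increment u w e)"
    by (simp add: sum_distrib_left sum_distrib_right sum.distrib[symmetric] algebra_simps)
  also have "\<dots> = 1 + (\<theta> * B)\<^sup>2"
    by (simp add: swap_increment_mean sum_edge_prob[OF connected card_ge_2])
  also have "\<dots> \<le> exp ((\<theta> * B)\<^sup>2)" by (rule exp_ge_add_one_self)
  finally show ?thesis .
qed

text \<open>With f = Lu and H(s) the swapped \<open>v\<close>, one swap changes u . H by -u . L_e H,
  whose conditional mean is -f . H. Hence \<open>poisson_sum\<close> plus u . H(t) is a
  martingale.\<close>

definition poisson_sum :: "real^'n \<Rightarrow> real^'n \<Rightarrow> (nat \<Rightarrow> 'n set) \<Rightarrow> nat \<Rightarrow> real" where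
  "poisson_sum u v \<xi> t = (\<Sum>s<t. (graph_laplacian E *v u) \<bullet> swapped_obs v \<xi> s)"

text \<open>The last summand has index \<open>s - 1\<close>, so even the sum up to
  \<open>Suc t\<close> is determined by the edges up to \<open>t\<close> and is unaffected by
  resampling edge \<open>Suc t\<close>.\<close>

lemma prefix_dependent_poisson_sum:
  "s \<le> Suc t \<Longrightarrow> prefix_dependent t (\<lambda>\<xi>. poisson_sum u v \<xi> s)"
  unfolding poisson_sum_def
  by (rule prefix_dependent_sum, rule prefix_dependent_comp[where g = "inner (graph_laplacian E *v u)"],
      rule prefix_dependent_mono[OF prefix_dependent_swapped_obs]) auto

lemma prefix_dependent_potential:
  "prefix_dependent t (\<lambda>\<xi>. exp (\<theta> * (poisson_sum u v \<xi> t + u \<bullet> swapped_obs v \<xi> t)))"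
proof (rule prefix_dependent_comp2[where g = "\<lambda>p w. exp (\<theta> * (p + u \<bullet> w))"])
  show "prefix_dependent t (\<lambda>\<xi>. poisson_sum u v \<xi> t)"
    by (rule prefix_dependent_poisson_sum) simp
qed (rule prefix_dependent_swapped_obs)

lemma poisson_sum_mgf:
  assumes B: "(norm (graph_laplacian E *v u) + 2 * norm u) * norm v \<le> B"
    and \<theta>: "\<theta> \<ge> 0" "\<theta> * B \<le> 1"
  shows "(LINT \<xi>|edge_seq_measure E. exp (\<theta> * (poisson_sum u v \<xi> t + u \<bullet> swapped_obs v \<xi> t)))
    \<le> exp (\<theta> * (u \<bullet> v)) * exp ((\<theta> * B)\<^sup>2 * t)"
proof (induction t)
  case 0
  interpret prob_space "edge_seq_measure E" by (rule prob_space_edge_seq)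
  show ?case by (simp add: poisson_sum_def prob_space)
next
  case (Suc t)
  define F where "F s \<xi> = exp (\<theta> * (poisson_sum u v \<xi> s + u \<bullet> swapped_obs v \<xi> s))" for s \<xi>
  have F: "prefix_dependent s (F s)" for s
    unfolding F_def by (rule prefix_dependent_potential)
  \<comment> \<open>Edge \<open>Suc t\<close> enters only through u . H(t+1), so the exponents
    differ by exactly one martingale increment.\<close>
  have step: "F (Suc t) (\<xi>(Suc t := e)) = F t \<xi> * exp (\<theta> * swap_increment u (swapped_obs v \<xi> t) e)"
    for \<xi> e
  proof -
    have 1: "poisson_sum u v (\<xi>(Suc t := e)) (Suc t) = poisson_sum u v \<xi> (Suc t)"
      by (rule prefix_dependent_upd[OF prefix_dependent_poisson_sum[of _ t]]) auto
    have 2: "swapped_obs v (\<xi>(Suc t := e)) t = swapped_obs v \<xi> t"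
      by (rule prefix_dependent_upd[OF prefix_dependent_swapped_obs]) auto
    show ?thesis
      unfolding F_def 1
      by (simp add: 2 swap_increment_def poisson_sum_def swap_matrix_mult inner_diff_right
          algebra_simps flip: exp_add)
  qed
  have "(LINT \<xi>|edge_seq_measure E. F (Suc t) \<xi>) =
      (LINT \<xi>|edge_seq_measure E. (\<Sum>e\<in>E. edge_prob E e * F (Suc t) (\<xi>(Suc t := e))))"
    by (rule integral_resample[OF F])
  also have "\<dots> \<le> (LINT \<xi>|edge_seq_measure E. F t \<xi> * exp ((\<theta> * B)\<^sup>2))"
  proof (rule integral_mono_AE)
    show "integrable (edge_seq_measure E) (\<lambda>\<xi>. \<Sum>e\<in>E. edge_prob E e * F (Suc t) (\<xi>(Suc t := e)))"
      unfolding step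
      by (rule integrable_prefix_dependent[of t], rule prefix_dependent_sum,
          rule prefix_dependent_comp2[where g = "\<lambda>a w. edge_prob E _ * (a * exp (\<theta> * swap_increment u w _))",
            OF F prefix_dependent_swapped_obs])
    show "integrable (edge_seq_measure E) (\<lambda>\<xi>. F t \<xi> * exp ((\<theta> * B)\<^sup>2))"
      by (intro integrable_mult_left integrable_prefix_dependent[OF F])
    show "AE \<xi> in edge_seq_measure E.
      (\<Sum>e\<in>E. edge_prob E e * F (Suc t) (\<xi>(Suc t := e))) \<le> F t \<xi> * exp ((\<theta> * B)\<^sup>2)"
      using AE_edges
    proof eventually_elim
      case (elim \<xi>)
      have "(\<Sum>e\<in>E. edge_prob E e * F (Suc t) (\<xi>(Suc t := e))) =
          F t \<xi> * (\<Sum>e\<in>E. edge_prob E e * exp (\<theta> * swap_increment u (swapped_obs v \<xi> t) e))"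
        by (simp add: step sum_distrib_left mult_ac)
      also have "\<dots> \<le> F t \<xi> * exp ((\<theta> * B)\<^sup>2)"
        using elim B
        by (intro mult_left_mono swap_increment_mgf \<theta>) (simp_all add: norm_swapped_obs F_def)
      finally show ?case .
    qed
  qed
  also have "\<dots> \<le> exp (\<theta> * (u \<bullet> v)) * exp ((\<theta> * B)\<^sup>2 * t) * exp ((\<theta> * B)\<^sup>2)"
    using Suc.IH by (simp add: F_def)
  finally show ?case by (simp add: F_def algebra_simps flip: exp_add)
qed

lemma poisson_sum_tail:
  fixes \<delta> :: real
  assumes "\<delta> > 0"
  obtains C \<kappa> :: real where "C \<ge> 0" "\<kappa> > 0"
    "\<And>t. (LINT \<xi>|edge_seq_measure E. of_bool (poisson_sum u v \<xi> t \<ge> \<delta> * t)) \<le> C * exp (- \<kappa> * t)"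
proof -
  \<comment> \<open>The summand 1 keeps \<open>B\<close> positive for the divisions below.\<close>
  define B where "B = (norm (graph_laplacian E *v u) + 2 * norm u) * norm v + 1"
  have B: "B \<ge> 1" by (simp add: B_def)
  \<comment> \<open>The first bound gives \<theta> B \<le> 1, as the moment estimate requires. The
    second makes the growth (\<theta> B)^2 t use at most half of the Chernoff exponent \<theta>
    \<delta> t.\<close>
  define \<theta> where "\<theta> = min (1 / B) (\<delta> / (2 * B\<^sup>2))"
  have \<theta>: "\<theta> > 0" using B assms by (simp add: \<theta>_def)
  have \<theta>B: "\<theta> * B \<le> 1"
  proof -
    have "\<theta> \<le> 1 / B" by (simp add: \<theta>_def)
    then show ?thesis using B by (simp add: field_simps)
  qed
  have \<theta>B2: "(\<theta> * B)\<^sup>2 \<le> \<theta> * \<delta> / 2"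
  proof -
    have "\<theta> \<le> \<delta> / (2 * B\<^sup>2)" by (simp add: \<theta>_def)
    then have "\<theta> * B\<^sup>2 \<le> \<delta> / 2" using B by (simp add: field_simps)
    then have "\<theta> * (\<theta> * B\<^sup>2) \<le> \<theta> * (\<delta> / 2)" using \<theta> by (intro mult_left_mono) auto
    then show ?thesis by (simp add: power2_eq_square mult_ac)
  qed
  \<comment> \<open>Compensates for dropping the bounded term u . H(t) from the exponent.\<close>
  define C where "C = exp (\<theta> * (norm u * norm v))"
  show thesis
  proof (rule that[of "C * exp (\<theta> * (u \<bullet> v))" "\<theta> * \<delta> / 2"])
    show "C * exp (\<theta> * (u \<bullet> v)) \<ge> 0" by (simp add: C_def)
    show "\<theta> * \<delta> / 2 > 0" using \<theta> assms by simp
    fix t :: nat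
    let ?F = "\<lambda>\<xi>. exp (\<theta> * (poisson_sum u v \<xi> t + u \<bullet> swapped_obs v \<xi> t))"
    have F: "prefix_dependent t ?F"
      by (rule prefix_dependent_potential)
    let ?I = "\<lambda>\<xi>. of_bool (poisson_sum u v \<xi> t \<ge> \<delta> * t) :: real"
    have I: "prefix_dependent t ?I"
      by (rule prefix_dependent_comp[where g = "\<lambda>p. of_bool (\<delta> * t \<le> p)"],
          rule prefix_dependent_poisson_sum) simp
    have "(LINT \<xi>|edge_seq_measure E. of_bool (poisson_sum u v \<xi> t \<ge> \<delta> * t)) \<le>
        (LINT \<xi>|edge_seq_measure E. C * exp (- \<theta> * \<delta> * t) * ?F \<xi>)"
    proof (rule integral_mono_AE)
      show "integrable (edge_seq_measure E) (\<lambda>\<xi>. of_bool (poisson_sum u v \<xi> t \<ge> \<delta> * t) :: real)"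
        by (rule integrable_prefix_dependent[OF I])
      show "integrable (edge_seq_measure E) (\<lambda>\<xi>. C * exp (- \<theta> * \<delta> * t) * ?F \<xi>)"
        by (intro integrable_mult_right integrable_prefix_dependent[OF F])
      show "AE \<xi> in edge_seq_measure E.
          of_bool (poisson_sum u v \<xi> t \<ge> \<delta> * t) \<le> C * exp (- \<theta> * \<delta> * t) * ?F \<xi>"
        using AE_edges
      proof eventually_elim
        case (elim \<xi>)
        have "\<bar>u \<bullet> swapped_obs v \<xi> t\<bar> \<le> norm u * norm v"
          using Cauchy_Schwarz_ineq2[of u "swapped_obs v \<xi> t"] elim by (simp add: norm_swapped_obs)
        then have *: "0 \<le> norm u * norm v + u \<bullet> swapped_obs v \<xi> t" by linarith
        have "C * exp (- \<theta> * \<delta> * t) * ?F \<xi> =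
          exp (\<theta> * ((norm u * norm v + u \<bullet> swapped_obs v \<xi> t) + (poisson_sum u v \<xi> t - \<delta> * t)))"
          by (simp add: C_def algebra_simps flip: exp_add)
        also have "\<dots> \<ge> of_bool (poisson_sum u v \<xi> t \<ge> \<delta> * t)"
          using * \<theta> by simp
        finally show ?case .
      qed
    qed
    also have "\<dots> = C * exp (- \<theta> * \<delta> * t) * (LINT \<xi>|edge_seq_measure E. ?F \<xi>)"
      by simp
    also have "\<dots> \<le> C * exp (- \<theta> * \<delta> * t) * (exp (\<theta> * (u \<bullet> v)) * exp ((\<theta> * B)\<^sup>2 * t))"
      using \<theta> by (intro mult_left_mono poisson_sum_mgf \<theta>B) (simp_all add: B_def C_def)
    also have "\<dots> \<le> C * exp (- \<theta> * \<delta> * t) * (exp (\<theta> * (u \<bullet> v)) * exp (\<theta> * \<delta> / 2 * t))"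
      using mult_right_mono[OF \<theta>B2, of "real t"] by (intro mult_left_mono) (simp_all add: C_def)
    also have "\<dots> = C * exp (\<theta> * (u \<bullet> v)) * exp (- (\<theta> * \<delta> / 2) * t)"
      by (simp add: mult_ac flip: exp_add)
    finally show "(LINT \<xi>|edge_seq_measure E. of_bool (poisson_sum u v \<xi> t \<ge> \<delta> * t)) \<le>
        C * exp (\<theta> * (u \<bullet> v)) * exp (- (\<theta> * \<delta> / 2) * t)" .
  qed
qed

text \<open>The sum 1 . H(s) stays at r_k - 1, so pairing H(s) with this right-hand side gives the
  indicator minus (r_k - 1)/n.\<close>

lemma rank_estimate_decomposition:
  assumes u: "graph_laplacian E *v u = axis k 1 - (1 / CARD('n)) *\<^sub>R 1"
    and edges: "\<And>s. \<xi> s \<in> E" and t: "t \<ge> 1"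
  shows "rank_estimate X \<xi> t k - rank_of X k =
    CARD('n) / t * poisson_sum u (\<chi> l. of_bool (X $ k > X $ l)) \<xi> t"
proof -
  let ?h = "(\<chi> l. of_bool (X $ k > X $ l)) :: real^'n"
  have H: "(graph_laplacian E *v u) \<bullet> swapped_obs ?h \<xi> s =
      of_bool (X $ k > swapped_obs X \<xi> s $ k) - (rank_of X k - 1) / CARD('n)" for s
  proof -
    have "1 \<bullet> swapped_obs ?h \<xi> s = rank_of X k - 1"
      using swapped_obs_inner_one[of \<xi> ?h s] edges by (simp add: rank_of_def inner_one_vec)
    moreover have "swapped_obs ?h \<xi> s $ k = of_bool (X $ k > swapped_obs X \<xi> s $ k)"
      using swapped_obs_map[of \<xi> "\<lambda>x. of_bool (X $ k > x)" X s] edges by simp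
    ultimately show ?thesis
      by (simp add: u inner_diff_left inner_axis')
  qed
  have "rank_estimate X \<xi> t k =
      1 + CARD('n) / t * (\<Sum>s<t. of_bool (X $ k > swapped_obs X \<xi> s $ k))"
    unfolding rank_estimate_def
    by (simp add: sum.atLeast1_atMost_eq)
  moreover have "poisson_sum u ?h \<xi> t =
      (\<Sum>s<t. of_bool (X $ k > swapped_obs X \<xi> s $ k)) - t * (rank_of X k - 1) / CARD('n)"
    by (simp add: poisson_sum_def H sum_subtractf)
  ultimately show ?thesis using t by (simp add: field_simps)
qed

lemma rank_estimate_tail:
  obtains C \<kappa> :: real where "C \<ge> 0" "\<kappa> > 0"
    "\<And>t. t \<ge> 1 \<Longrightarrow>
      (LINT \<xi>|edge_seq_measure E. of_bool (\<bar>rank_estimate X \<xi> t k - rank_of X k\<bar> \<ge> 1/2))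
        \<le> C * exp (- \<kappa> * t)"
proof -
  let ?h = "(\<chi> l. of_bool (X $ k > X $ l)) :: real^'n"
  have "1 \<bullet> (axis k 1 - (1 / CARD('n)) *\<^sub>R 1 :: real^'n) = 0"
    by (simp add: inner_diff_right inner_axis) (simp add: inner_one_vec)
  then obtain u where u: "graph_laplacian E *v u = axis k 1 - (1 / CARD('n)) *\<^sub>R 1"
    by (rule graph_laplacian_range)
  \<comment> \<open>A rank error of 1/2 is a Poisson sum of size t/(2n). The two signs are handled
    by \<open>u\<close> and \<open>- u\<close>.\<close>
  define \<delta> where "\<delta> = 1 / (2 * real CARD('n))"
  have \<delta>: "\<delta> > 0" by (simp add: \<delta>_def)
  obtain C1 \<kappa>1 :: real where 1: "C1 \<ge> 0" "\<kappa>1 > 0"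
    "\<And>t. (LINT \<xi>|edge_seq_measure E. of_bool (poisson_sum u ?h \<xi> t \<ge> \<delta> * t)) \<le> C1 * exp (- \<kappa>1 * t)"
    by (rule poisson_sum_tail[OF \<delta>, of u ?h]) (rule that)
  obtain C2 \<kappa>2 :: real where 2: "C2 \<ge> 0" "\<kappa>2 > 0"
    "\<And>t. (LINT \<xi>|edge_seq_measure E. of_bool (poisson_sum (- u) ?h \<xi> t \<ge> \<delta> * t)) \<le> C2 * exp (- \<kappa>2 * t)"
    by (rule poisson_sum_tail[OF \<delta>, of "- u" ?h]) (rule that)
  define \<kappa> where "\<kappa> = min \<kappa>1 \<kappa>2"
  have neg: "poisson_sum (- u) ?h \<xi> t = - poisson_sum u ?h \<xi> t" for \<xi> t
  proof -
    have "graph_laplacian E *v (- u) = - (graph_laplacian E *v u)"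
      using matrix_vector_mult_scaleR[of "graph_laplacian E" "-1" u] by simp
    then show ?thesis by (simp add: poisson_sum_def sum_negf)
  qed
  show thesis
  proof (rule that)
    show "C1 + C2 \<ge> 0" "\<kappa> > 0" using 1 2 by (auto simp: \<kappa>_def)
    fix t :: nat assume t: "t \<ge> 1"
    let ?I = "\<lambda>u \<xi>. of_bool (poisson_sum u ?h \<xi> t \<ge> \<delta> * t) :: real"
    have int: "integrable (edge_seq_measure E) (?I u)" for u
      by (rule integrable_prefix_dependent[of t],
          rule prefix_dependent_comp[where g = "\<lambda>p. of_bool (\<delta> * t \<le> p)"],
          rule prefix_dependent_poisson_sum) simp
    have "(LINT \<xi>|edge_seq_measure E. of_bool (\<bar>rank_estimate X \<xi> t k - rank_of X k\<bar> \<ge> 1/2)) \<le>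
        (LINT \<xi>|edge_seq_measure E. ?I u \<xi> + ?I (- u) \<xi>)"
    proof (rule integral_mono_AE')
      show "integrable (edge_seq_measure E) (\<lambda>\<xi>. ?I u \<xi> + ?I (- u) \<xi>)"
        by (intro Bochner_Integration.integrable_add int)
      show "AE \<xi> in edge_seq_measure E.
          of_bool (\<bar>rank_estimate X \<xi> t k - rank_of X k\<bar> \<ge> 1/2) \<le> ?I u \<xi> + ?I (- u) \<xi>"
        using AE_edges
      proof eventually_elim
        case (elim \<xi>)
        have "poisson_sum u ?h \<xi> t \<ge> \<delta> * t \<or> - poisson_sum u ?h \<xi> t \<ge> \<delta> * t"
          if "\<bar>rank_estimate X \<xi> t k - rank_of X k\<bar> \<ge> 1/2"
        proof -
          have "1/2 \<le> CARD('n) / t * \<bar>poisson_sum u ?h \<xi> t\<bar>"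
            using that rank_estimate_decomposition[OF u, of \<xi> t X] elim t by (simp add: abs_mult)
          then have "\<bar>poisson_sum u ?h \<xi> t\<bar> \<ge> \<delta> * t"
            using t by (simp add: \<delta>_def field_simps)
          then show ?thesis by linarith
        qed
        then show ?case by (auto simp: neg)
      qed
    qed auto
    also have "\<dots> = (LINT \<xi>|edge_seq_measure E. ?I u \<xi>) + (LINT \<xi>|edge_seq_measure E. ?I (- u) \<xi>)"
      by (intro Bochner_Integration.integral_add int)
    also have "\<dots> \<le> C1 * exp (- \<kappa>1 * t) + C2 * exp (- \<kappa>2 * t)"
      by (intro add_mono 1 2)
    also have "\<dots> \<le> C1 * exp (- \<kappa> * t) + C2 * exp (- \<kappa> * t)"
      using 1 2 by (intro add_mono mult_left_mono) (auto simp: \<kappa>_def intro!: mult_right_mono)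
    finally show "(LINT \<xi>|edge_seq_measure E. of_bool (\<bar>rank_estimate X \<xi> t k - rank_of X k\<bar> \<ge> 1/2))
        \<le> (C1 + C2) * exp (- \<kappa> * t)"
      by (simp add: distrib_right)
  qed
qed

end

section \<open>Averaging and trimmed weights\<close>

lemma prefix_dependent_avg_prod: "prefix_dependent t (\<lambda>\<xi> :: nat \<Rightarrow> 'n::finite set. avg_prod \<xi> t s)"
proof (induction t)
  case (Suc t)
  have "prefix_dependent (Suc t) (\<lambda>\<xi> :: nat \<Rightarrow> 'n set. avg_matrix (\<xi> (Suc t)) ** avg_prod \<xi> t s)"
    using prefix_dependent_comp2[OF prefix_dependent_nth[OF order_refl, where g = avg_matrix]
        prefix_dependent_mono[OF Suc le_SucI[OF order_refl]], of "(**)"] .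
  then show ?case by (cases "s \<le> Suc t") (simp_all add: prefix_dependent_const)
qed (simp add: prefix_dependent_const)

text \<open>The empty product, so \<open>avg_prod \<xi> (s + j) (Suc s)\<close> has exactly
  \<open>j\<close> factors.\<close>

lemma avg_prod_self: "avg_prod \<xi> s (Suc s) = mat 1"
  by (cases s) auto

lemma avg_prod_Suc_mult:
  "s \<le> t \<Longrightarrow> avg_prod \<xi> (Suc t) (Suc s) *v v = avg_matrix (\<xi> (Suc t)) *v (avg_prod \<xi> t (Suc s) *v v)"
  by (simp add: matrix_vector_mul_assoc)

context gossip_graph
begin

lemma avg_prod_inner_one:
  assumes "\<And>i. \<xi> i \<in> E"
  shows "1 \<bullet> (avg_prod \<xi> t s *v v) = 1 \<bullet> v"
proof (induction t)
  case (Suc t)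
  then show ?case using assms
    by (simp add: avg_matrix_inner_one flip: matrix_vector_mul_assoc)
qed simp

lemma avg_prod_one:
  assumes "\<And>i. \<xi> i \<in> E"
  shows "avg_prod \<xi> t s *v 1 = 1"
proof (induction t)
  case (Suc t)
  then show ?case using assms
    by (simp add: avg_matrix_one flip: matrix_vector_mul_assoc)
qed simp

text \<open>The product involves only edges after \<open>s\<close>, which are fresh for
  \<open>V\<close>, and the averaged vector stays orthogonal to \<open>1\<close>; each step thus
  contracts the second moment by 1 - g/2. The rate is uniform in \<open>V\<close>, \<open>s\<close>
  and \<open>D\<close>, as the starting time will move with \<open>t\<close>.\<close>

lemma avg_prod_expected_contraction:
  obtains \<rho> :: real where "0 < \<rho>" "\<rho> < 1"
    "\<And>V s j D. prefix_dependent s V \<Longrightarrow>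
      (\<forall>\<xi>. (\<forall>i. \<xi> i \<in> E) \<longrightarrow> 1 \<bullet> V \<xi> = 0 \<and> norm (V \<xi>) \<le> D) \<Longrightarrow>
      (LINT \<xi>|edge_seq_measure E. norm (avg_prod \<xi> (s + j) (Suc s) *v V \<xi>)) \<le> \<rho> ^ j * (1 + D\<^sup>2)"
proof -
  interpret prob_space "edge_seq_measure E" by (rule prob_space_edge_seq)
  obtain g0 where g0: "g0 > 0" "\<And>v. 1 \<bullet> v = 0 \<Longrightarrow> v \<bullet> (graph_laplacian E *v v) \<ge> g0 * (norm v)\<^sup>2"
    by (rule spectral_gap) (rule that)
  \<comment> \<open>Capping at 1 keeps \<open>q\<close> at least 1/2, so its root can be divided
    by.\<close>
  define g where "g = min g0 1"
  define q where "q = 1 - g / 2"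
  have q: "0 < q" "q < 1" using g0(1) by (auto simp: q_def g_def)
  have step: "(\<Sum>e\<in>E. edge_prob E e * (norm (avg_matrix e *v w))\<^sup>2) \<le> q * (norm w)\<^sup>2"
    if w: "1 \<bullet> w = 0" for w
  proof -
    have "(\<Sum>e\<in>E. edge_prob E e * (norm (avg_matrix e *v w))\<^sup>2) =
        (\<Sum>e\<in>E. edge_prob E e * ((norm w)\<^sup>2 - 1/2 * (w \<bullet> (edge_laplacian e *v w))))"
      by (intro sum.cong refl) (simp add: norm_avg_matrix_mult)
    also have "\<dots> = (\<Sum>e\<in>E. edge_prob E e) * (norm w)\<^sup>2 - 1/2 * (w \<bullet> (graph_laplacian E *v w))"
      by (simp add: graph_laplacian_mult inner_sum_right right_diff_distrib sum_subtractf
          sum_distrib_left sum_distrib_right mult_ac)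
    also have "\<dots> = (norm w)\<^sup>2 - 1/2 * (w \<bullet> (graph_laplacian E *v w))"
      by (simp add: sum_edge_prob[OF connected card_ge_2])
    also have "\<dots> \<le> (norm w)\<^sup>2 - 1/2 * (g * (norm w)\<^sup>2)"
      using order_trans[OF mult_right_mono[of g g0 "(norm w)\<^sup>2"] g0(2)[OF w]] by (simp add: g_def)
    also have "\<dots> = q * (norm w)\<^sup>2" by (simp add: q_def algebra_simps)
    finally show ?thesis .
  qed
  show thesis
  proof (rule that)
    show "0 < sqrt q" "sqrt q < 1" using q by auto
    fix V :: "(nat \<Rightarrow> 'n set) \<Rightarrow> real^'n" and s j :: nat and D :: real
    assume V: "prefix_dependent s V"
      and "\<forall>\<xi>. (\<forall>i. \<xi> i \<in> E) \<longrightarrow> 1 \<bullet> V \<xi> = 0 \<and> norm (V \<xi>) \<le> D"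
    then have cent: "\<And>\<xi>. (\<And>i. \<xi> i \<in> E) \<Longrightarrow> 1 \<bullet> V \<xi> = 0 \<and> norm (V \<xi>) \<le> D" by blast
    let ?A = "\<lambda>j \<xi>. avg_prod \<xi> (s + j) (Suc s) *v V \<xi>"
    have A: "prefix_dependent (s + j) (?A j)" for j
      by (rule prefix_dependent_comp2[where g = "(*v)", OF prefix_dependent_avg_prod
            prefix_dependent_mono[OF V]]) simp
    have int2: "integrable (edge_seq_measure E) (\<lambda>\<xi>. (norm (?A j \<xi>))\<^sup>2)" for j
      by (rule integrable_prefix_dependent, rule prefix_dependent_comp[where g = "\<lambda>v. (norm v)\<^sup>2", OF A])
    have sq: "(LINT \<xi>|edge_seq_measure E. (norm (?A j \<xi>))\<^sup>2) \<le> q ^ j * D\<^sup>2" for j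
    proof (induction j)
      case 0
      have "(LINT \<xi>|edge_seq_measure E. (norm (?A 0 \<xi>))\<^sup>2) \<le> (LINT \<xi>|edge_seq_measure E. D\<^sup>2)"
      proof (rule integral_mono_AE[OF int2])
        show "AE \<xi> in edge_seq_measure E. (norm (?A 0 \<xi>))\<^sup>2 \<le> D\<^sup>2"
          using AE_edges by eventually_elim (simp add: avg_prod_self cent power_mono)
      qed simp
      then show ?case by (simp add: prob_space)
    next
      case (Suc j)
      have upd: "?A (Suc j) (\<xi>(Suc (s + j) := e)) = avg_matrix e *v ?A j \<xi>" for \<xi> e
      proof -
        have "?A j (\<xi>(Suc (s + j) := e)) = ?A j \<xi>"
          by (rule prefix_dependent_upd[OF A]) simp
        moreover have "?A (Suc j) (\<xi>(Suc (s + j) := e)) =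
            avg_matrix e *v ?A j (\<xi>(Suc (s + j) := e))"
          using avg_prod_Suc_mult[of s "s + j" "\<xi>(Suc (s + j) := e)"] by (simp del: avg_prod.simps)
        ultimately show ?thesis by simp
      qed
      have "(LINT \<xi>|edge_seq_measure E. (norm (?A (Suc j) \<xi>))\<^sup>2) =
          (LINT \<xi>|edge_seq_measure E. (\<Sum>e\<in>E. edge_prob E e * (norm (?A (Suc j) (\<xi>(Suc (s + j) := e))))\<^sup>2))"
        by (rule integral_resample, rule prefix_dependent_comp[where g = "\<lambda>v. (norm v)\<^sup>2", OF A])
      also have "\<dots> = (LINT \<xi>|edge_seq_measure E. (\<Sum>e\<in>E. edge_prob E e * (norm (avg_matrix e *v ?A j \<xi>))\<^sup>2))"
        by (simp only: upd)
      also have "\<dots> \<le> (LINT \<xi>|edge_seq_measure E. q * (norm (?A j \<xi>))\<^sup>2)"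
      proof (rule integral_mono_AE)
        show "integrable (edge_seq_measure E)
            (\<lambda>\<xi>. \<Sum>e\<in>E. edge_prob E e * (norm (avg_matrix e *v ?A j \<xi>))\<^sup>2)"
          by (rule integrable_prefix_dependent,
              rule prefix_dependent_comp[where g = "\<lambda>v. \<Sum>e\<in>E. edge_prob E e * (norm (avg_matrix e *v v))\<^sup>2", OF A])
        show "integrable (edge_seq_measure E) (\<lambda>\<xi>. q * (norm (?A j \<xi>))\<^sup>2)"
          by (intro integrable_mult_right int2)
        show "AE \<xi> in edge_seq_measure E. (\<Sum>e\<in>E. edge_prob E e * (norm (avg_matrix e *v ?A j \<xi>))\<^sup>2)
            \<le> q * (norm (?A j \<xi>))\<^sup>2"
          using AE_edges
        proof eventually_elim
          case (elim \<xi>)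
          show ?case by (rule step) (use elim in \<open>simp add: avg_prod_inner_one cent\<close>)
        qed
      qed
      also have "\<dots> \<le> q * (q ^ j * D\<^sup>2)"
        using Suc.IH q by simp
      finally show ?case by (simp add: mult_ac)
    qed
    \<comment> \<open>Passage to the first moment by x \<le> a + x^2/a: with a^2 = q^j both terms
      are of order a, giving a (1 + D^2).\<close>
    define a where "a = sqrt q ^ j"
    have a: "a > 0" using q by (simp add: a_def)
    have q_pow: "q ^ j = a * a" using q by (simp add: a_def flip: power_mult_distrib)
    have amgm: "x \<le> a + x\<^sup>2 / a" for x
    proof -
      have "0 \<le> (x - a / 2)\<^sup>2 + 3 / 4 * a\<^sup>2" by simp
      then have "x * a \<le> a * a + x\<^sup>2" by (simp add: power2_eq_square algebra_simps)
      then show ?thesis using a by (simp add: field_simps)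
    qed
    have "(LINT \<xi>|edge_seq_measure E. norm (?A j \<xi>)) \<le>
        (LINT \<xi>|edge_seq_measure E. a + (norm (?A j \<xi>))\<^sup>2 / a)"
    proof (rule integral_mono)
      show "integrable (edge_seq_measure E) (\<lambda>\<xi>. norm (?A j \<xi>))"
        by (rule integrable_prefix_dependent, rule prefix_dependent_comp[where g = norm, OF A])
      show "integrable (edge_seq_measure E) (\<lambda>\<xi>. a + (norm (?A j \<xi>))\<^sup>2 / a)"
        by (intro Bochner_Integration.integrable_add integrable_const integrable_divide int2)
      show "norm (?A j \<xi>) \<le> a + (norm (?A j \<xi>))\<^sup>2 / a" for \<xi> by (rule amgm)
    qed
    also have "\<dots> = a + (LINT \<xi>|edge_seq_measure E. (norm (?A j \<xi>))\<^sup>2) / a"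
      by (subst Bochner_Integration.integral_add) (auto intro: int2 simp: prob_space)
    also have "\<dots> \<le> a + (q ^ j * D\<^sup>2) / a"
      using sq[of j] a by (intro add_left_mono divide_right_mono) auto
    also have "\<dots> = a * (1 + D\<^sup>2)" using a by (simp add: q_pow distrib_left)
    finally show "(LINT \<xi>|edge_seq_measure E. norm (?A j \<xi>)) \<le> sqrt q ^ j * (1 + D\<^sup>2)"
      by (simp add: a_def)
  qed
qed

end

section \<open>Ranks as a bijection and the exact trimmed weights\<close>

lemma rank_of_eq: "rank_of X k = real (Suc (card {l. X $ l < X $ k}))"
proof -
  have "(\<Sum>l\<in>UNIV. of_bool (X $ k > X $ l)) = (\<Sum>l\<in>{l. X $ l < X $ k}. 1 :: real)"
    by (intro sum.mono_neutral_cong_right) auto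
  then show ?thesis by (simp add: rank_of_def)
qed

lemma bij_betw_rank:
  fixes X :: "real^'n"
  assumes "inj (($) X)"
  shows "bij_betw (\<lambda>k. card {l. X $ l < X $ k}) UNIV {..<CARD('n)}"
proof -
  let ?r = "\<lambda>k. card {l. X $ l < X $ k}"
  have less: "?r k < ?r l" if "X $ k < X $ l" for k l
    using that by (intro psubset_card_mono) auto
  have "inj ?r"
  proof (rule injI)
    fix k l assume "?r k = ?r l"
    then have "X $ k = X $ l" using less[of k l] less[of l k] by linarith
    then show "k = l" using assms by (simp add: inj_eq)
  qed
  moreover have "?r k < CARD('n)" for k
    by (intro psubset_card_mono) auto
  then have "range ?r \<subseteq> {..<CARD('n)}" by auto
  ultimately show ?thesis
    unfolding bij_betw_def by (simp add: card_subset_eq card_image)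
qed

context
  fixes \<alpha> :: real and n :: nat
  assumes \<alpha>: "0 < \<alpha>" "\<alpha> < 1/2" and n: "n > 0"
begin

lemma trim_m_less: "2 * trim_m n \<alpha> < n"
proof -
  have "real (trim_m n \<alpha>) \<le> \<alpha> * n" using \<alpha> by (simp add: trim_m_def)
  also have "\<dots> < 1/2 * n" using \<alpha> n by (intro mult_strict_right_mono) auto
  finally show ?thesis by linarith
qed

lemma trim_c_eq: "trim_c n \<alpha> = real (n - 2 * trim_m n \<alpha>) / n"
  using trim_m_less n by (simp add: trim_c_def field_simps of_nat_diff)

lemma trim_c_pos: "trim_c n \<alpha> > 0"
  using trim_m_less n by (simp add: trim_c_eq)

lemma trim_weight_rank:
  assumes "\<bar>r - real (Suc j)\<bar> < 1/2"
  shows "trim_weight n \<alpha> r = of_bool (trim_m n \<alpha> \<le> j \<and> j < n - trim_m n \<alpha>) / trim_c n \<alpha>"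
proof -
  have "r \<in> {trim_a n \<alpha>..trim_b n \<alpha>} \<longleftrightarrow> trim_m n \<alpha> \<le> j \<and> j < n - trim_m n \<alpha>"
    using assms trim_m_less unfolding trim_a_def trim_b_def atLeastAtMost_iff by linarith
  then show ?thesis by (simp add: trim_weight_def)
qed

lemma trim_weight_diff_le: "\<bar>trim_weight n \<alpha> r - trim_weight n \<alpha> r'\<bar> \<le> 1 / trim_c n \<alpha>"
  using trim_c_pos by (auto simp: trim_weight_def indicator_def)

end

lemma trim_weight_eqI:
  assumes "0 < \<alpha>" "\<alpha> < 1/2" "\<bar>r - rank_of X k\<bar> < 1/2"
  shows "trim_weight CARD('n) \<alpha> r = trim_weight CARD('n) \<alpha> (rank_of (X :: real^'n) k)"
proof -
  let ?j = "card {l. X $ l < X $ k}" and ?m = "trim_m CARD('n) \<alpha>"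
  have "trim_weight CARD('n) \<alpha> r =
      of_bool (?m \<le> ?j \<and> ?j < CARD('n) - ?m) / trim_c CARD('n) \<alpha>"
    using assms by (intro trim_weight_rank) (simp_all add: rank_of_eq)
  also have "\<dots> = trim_weight CARD('n) \<alpha> (rank_of X k)"
    unfolding rank_of_eq using assms by (intro trim_weight_rank[symmetric]) simp_all
  finally show ?thesis .
qed

text \<open>Exactly n - 2m ranks are kept, each with weight n/(n - 2m). This is why the limit of M
  is the all-ones vector.\<close>

lemma sum_trim_weight_rank:
  fixes X :: "real^'n"
  assumes \<alpha>: "0 < \<alpha>" "\<alpha> < 1/2" and "inj (($) X)"
  shows "(\<Sum>k\<in>UNIV. trim_weight CARD('n) \<alpha> (rank_of X k)) = CARD('n)"
proof -
  let ?n = "CARD('n)" and ?m = "trim_m CARD('n) \<alpha>"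
  have m: "2 * ?m < ?n" using trim_m_less[OF \<alpha>, of ?n] by simp
  have "(\<Sum>k\<in>UNIV. trim_weight ?n \<alpha> (rank_of X k)) = (\<Sum>j<?n. trim_weight ?n \<alpha> (real (Suc j)))"
    unfolding rank_of_eq
    using sum.reindex_bij_betw[OF bij_betw_rank[OF assms(3)], of "\<lambda>j. trim_weight ?n \<alpha> (real (Suc j))"] .
  also have "\<dots> = (\<Sum>j<?n. of_bool (?m \<le> j \<and> j < ?n - ?m) / trim_c ?n \<alpha>)"
    using \<alpha> by (intro sum.cong refl trim_weight_rank) auto
  also have "\<dots> = (\<Sum>j<?n. of_bool (?m \<le> j \<and> j < ?n - ?m)) / trim_c ?n \<alpha>"
    by (rule sum_divide_distrib[symmetric])
  also have "(\<Sum>j<?n. of_bool (?m \<le> j \<and> j < ?n - ?m)) = (\<Sum>j\<in>{?m..<?n - ?m}. 1 :: real)"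
    by (intro sum.mono_neutral_cong_right) auto
  also have "\<dots> = real (?n - 2 * ?m)" by simp
  also have "\<dots> / trim_c ?n \<alpha> = ?n"
    using trim_c_eq[OF \<alpha>, of ?n] m by simp
  finally show ?thesis .
qed

section \<open>The GoTrim sums\<close>

text \<open>Common form of N (\<open>y = X\<close>) and M (\<open>y = 1\<close>), so that each
  estimate is proved once.\<close>

definition gotrim_sum ::
    "real \<Rightarrow> real^'n \<Rightarrow> real^'n \<Rightarrow> (nat \<Rightarrow> ('n::finite) set) \<Rightarrow> nat \<Rightarrow> real^'n" where
  "gotrim_sum \<alpha> X y \<xi> t = (\<Sum>s=1..t. avg_prod \<xi> t s *v (weight_increment \<alpha> X \<xi> s * y))"

lemma gotrim_N_eq: "gotrim_N \<alpha> X \<xi> t = gotrim_sum \<alpha> X X \<xi> t"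
  by (simp add: gotrim_N_def gotrim_sum_def)

lemma gotrim_M_eq: "gotrim_M \<alpha> X \<xi> t = gotrim_sum \<alpha> X 1 \<xi> t"
  by (simp add: gotrim_M_def gotrim_sum_def)

lemma gotrim_sum_0: "gotrim_sum \<alpha> X y \<xi> 0 = 0"
  by (simp add: gotrim_sum_def)

lemma gotrim_sum_Suc:
  "gotrim_sum \<alpha> X y \<xi> (Suc t) =
    avg_matrix (\<xi> (Suc t)) *v (gotrim_sum \<alpha> X y \<xi> t + weight_increment \<alpha> X \<xi> (Suc t) * y)"
proof -
  have "gotrim_sum \<alpha> X y \<xi> (Suc t) =
      (\<Sum>s=1..t. avg_prod \<xi> (Suc t) s *v (weight_increment \<alpha> X \<xi> s * y)) +
      avg_prod \<xi> (Suc t) (Suc t) *v (weight_increment \<alpha> X \<xi> (Suc t) * y)"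
    by (simp add: gotrim_sum_def del: avg_prod.simps)
  also have "(\<Sum>s=1..t. avg_prod \<xi> (Suc t) s *v (weight_increment \<alpha> X \<xi> s * y)) =
      avg_matrix (\<xi> (Suc t)) *v gotrim_sum \<alpha> X y \<xi> t"
    unfolding gotrim_sum_def linear_sum[OF matrix_vector_mul_linear]
    by (intro sum.cong refl) (simp add: matrix_vector_mul_assoc)
  also have "avg_prod \<xi> (Suc t) (Suc t) = avg_matrix (\<xi> (Suc t))"
    by (simp add: avg_prod_self)
  finally show ?thesis by (simp add: matrix_vector_right_distrib)
qed

lemma prefix_dependent_rank_estimate:
  "prefix_dependent s (\<lambda>\<xi>. rank_estimate X \<xi> s k)"
proof -
  have "prefix_dependent s (\<lambda>\<xi>. of_bool (X $ k > swapped_obs X \<xi> (i - 1) $ k) :: real)"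
    if "i \<in> {1..s}" for i
    by (rule prefix_dependent_comp[where g = "\<lambda>w. of_bool (X $ k > w $ k)"],
        rule prefix_dependent_mono[OF prefix_dependent_swapped_obs]) (use that in auto)
  then have "prefix_dependent s (\<lambda>\<xi>. \<Sum>i=1..s. of_bool (X $ k > swapped_obs X \<xi> (i - 1) $ k) :: real)"
    by (rule prefix_dependent_sum)
  then show ?thesis
    unfolding rank_estimate_def
    by (rule prefix_dependent_comp[where g = "\<lambda>x. 1 + real CARD(_) / real s * x"])
qed

lemma prefix_dependent_weight_estimate: "prefix_dependent s (\<lambda>\<xi>. weight_estimate \<alpha> X \<xi> s)"
  unfolding prefix_dependent_def
proof (intro allI impI)
  fix \<xi> \<xi>' :: "nat \<Rightarrow> 'a set" assume "\<forall>i\<le>s. \<xi> i = \<xi>' i"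
  then have "rank_estimate X \<xi> s k = rank_estimate X \<xi>' s k" for k
    using prefix_dependentD[OF prefix_dependent_rank_estimate] by blast
  then show "weight_estimate \<alpha> X \<xi> s = weight_estimate \<alpha> X \<xi>' s"
    by (simp add: weight_estimate_def)
qed

lemma prefix_dependent_weight_increment: "prefix_dependent s (\<lambda>\<xi>. weight_increment \<alpha> X \<xi> s)"
  unfolding weight_increment_def
  by (rule prefix_dependent_comp2[where g = "(-)"],
      rule prefix_dependent_weight_estimate,
      rule prefix_dependent_mono[OF prefix_dependent_weight_estimate]) simp

lemma prefix_dependent_gotrim_sum: "prefix_dependent t (\<lambda>\<xi>. gotrim_sum \<alpha> X y \<xi> t)"
  unfolding gotrim_sum_def
proof (rule prefix_dependent_sum)
  fix s assume "s \<in> {1..t}"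
  then show "prefix_dependent t (\<lambda>\<xi>. avg_prod \<xi> t s *v (weight_increment \<alpha> X \<xi> s * y))"
    by (intro prefix_dependent_comp2[where g = "\<lambda>A w. A *v (w * y)", OF prefix_dependent_avg_prod
          prefix_dependent_mono[OF prefix_dependent_weight_increment]]) simp
qed

section \<open>Pathwise estimates: conserved sums, growth and deviation from the mean\<close>

lemma norm_mult_vec_le:
  fixes x y :: "real^'n"
  assumes "\<And>i. \<bar>x $ i\<bar> \<le> c"
  shows "norm (x * y) \<le> c * norm y"
proof -
  have "c \<ge> 0" using assms abs_ge_zero order_trans by blast
  then have "norm (x * y) \<le> norm (c *\<^sub>R y)"
    using assms by (intro norm_le_componentwise_cart) (simp add: abs_mult mult_right_mono)
  then show ?thesis using \<open>c \<ge> 0\<close> by simp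
qed

definition centered :: "real^'n \<Rightarrow> real^'n" where
  "centered v = v - ((1 \<bullet> v) / CARD('n)) *\<^sub>R 1"

lemma inner_one_centered: "1 \<bullet> centered v = 0"
  by (simp add: centered_def inner_diff_right) (simp add: inner_one_vec)

lemma norm_centered_le: "norm (centered v) \<le> norm v" for v :: "real^'n"
proof -
  have "(norm (centered v))\<^sup>2 = (norm v)\<^sup>2 - (1 \<bullet> v)\<^sup>2 / CARD('n)"
  proof -
    have "(1 :: real^'n) \<bullet> 1 = CARD('n)" by (simp add: inner_one_vec)
    then show ?thesis
      unfolding power2_norm_eq_inner centered_def
      by (simp add: inner_diff_left inner_diff_right inner_commute[of v 1] power2_eq_square field_simps)
  qed
  also have "\<dots> \<le> (norm v)\<^sup>2" by simp
  finally show ?thesis by (rule power2_le_imp_le) simp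
qed

context gossip_graph
begin

text \<open>Averaging preserves the coordinate sum, so the injected increments telescope to the
  current weights.\<close>

lemma gotrim_sum_inner_one:
  assumes "\<And>s. \<xi> s \<in> E"
  shows "1 \<bullet> gotrim_sum \<alpha> X y \<xi> t = 1 \<bullet> (weight_estimate \<alpha> X \<xi> t * y)"
proof (induction t)
  case 0
  then show ?case by (simp add: gotrim_sum_0 weight_estimate_def)
next
  case (Suc t)
  have "weight_estimate \<alpha> X \<xi> t * y + weight_increment \<alpha> X \<xi> (Suc t) * y =
      weight_estimate \<alpha> X \<xi> (Suc t) * y"
    by (simp add: weight_increment_def algebra_simps)
  moreover have "1 \<bullet> gotrim_sum \<alpha> X y \<xi> (Suc t) =
      1 \<bullet> (weight_estimate \<alpha> X \<xi> t * y + weight_increment \<alpha> X \<xi> (Suc t) * y)"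
    using assms by (simp add: gotrim_sum_Suc avg_matrix_inner_one inner_add_right Suc)
  ultimately show ?case by simp
qed

lemma gotrim_sum_norm:
  assumes "\<And>s. \<xi> s \<in> E" and \<alpha>: "0 < \<alpha>" "\<alpha> < 1/2"
  shows "norm (gotrim_sum \<alpha> X y \<xi> t) \<le> t * (norm y / trim_c CARD('n) \<alpha>)"
proof (induction t)
  case 0
  then show ?case by (simp add: gotrim_sum_0)
next
  case (Suc t)
  have n: "0 < CARD('n)" by simp
  have c: "trim_c CARD('n) \<alpha> > 0" by (rule trim_c_pos[OF \<alpha> n])
  \<comment> \<open>The first increment starts from weight 0 instead of a trimmed weight, hence the
    case distinction on \<open>t\<close>.\<close>
  have "\<bar>weight_increment \<alpha> X \<xi> (Suc t) $ i\<bar> \<le> 1 / trim_c CARD('n) \<alpha>" for i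
    using trim_weight_diff_le[OF \<alpha> n] c
    by (cases t) (auto simp: weight_increment_def weight_estimate_def trim_weight_def indicator_def)
  then have "norm (weight_increment \<alpha> X \<xi> (Suc t) * y) \<le> 1 / trim_c CARD('n) \<alpha> * norm y"
    by (rule norm_mult_vec_le)
  moreover have "norm (gotrim_sum \<alpha> X y \<xi> (Suc t)) \<le>
      norm (gotrim_sum \<alpha> X y \<xi> t) + norm (weight_increment \<alpha> X \<xi> (Suc t) * y)"
    unfolding gotrim_sum_Suc
    using norm_avg_matrix_le[OF assms(1)] norm_triangle_ineq order_trans by blast
  ultimately have "norm (gotrim_sum \<alpha> X y \<xi> (Suc t)) \<le>
      t * (norm y / trim_c CARD('n) \<alpha>) + 1 / trim_c CARD('n) \<alpha> * norm y"
    using Suc by linarith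
  then show ?case by (simp add: algebra_simps add_divide_distrib)
qed

lemma gotrim_sum_stationary:
  assumes "\<And>s. \<tau> < s \<Longrightarrow> s \<le> \<tau> + j \<Longrightarrow> weight_increment \<alpha> X \<xi> s = 0"
  shows "gotrim_sum \<alpha> X y \<xi> (\<tau> + j) = avg_prod \<xi> (\<tau> + j) (Suc \<tau>) *v gotrim_sum \<alpha> X y \<xi> \<tau>"
  using assms
proof (induction j)
  case 0
  then show ?case by (simp add: avg_prod_self)
next
  case (Suc j)
  then have "gotrim_sum \<alpha> X y \<xi> (\<tau> + Suc j) = avg_matrix (\<xi> (Suc (\<tau> + j))) *v gotrim_sum \<alpha> X y \<xi> (\<tau> + j)"
    by (simp add: gotrim_sum_Suc)
  also have "\<dots> = avg_prod \<xi> (Suc (\<tau> + j)) (Suc \<tau>) *v gotrim_sum \<alpha> X y \<xi> \<tau>"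
    using Suc by (subst avg_prod_Suc_mult) simp_all
  finally show ?case by simp
qed

text \<open>Nothing is injected after \<tau>, and the averaging product fixes \<open>1\<close>, so
  subtracting the mean commutes with it. The weights must be exact at \<tau> itself too, because the
  increment at \<tau> + 1 refers to it.\<close>

lemma gotrim_sum_deviation:
  assumes edges: "\<And>s. \<xi> s \<in> E"
    and weights: "\<And>s. \<tau> \<le> s \<Longrightarrow> s \<le> \<tau> + j \<Longrightarrow> weight_estimate \<alpha> X \<xi> s = w"
  shows "gotrim_sum \<alpha> X y \<xi> (\<tau> + j) - ((1 \<bullet> (w * y)) / CARD('n)) *\<^sub>R 1 =
    avg_prod \<xi> (\<tau> + j) (Suc \<tau>) *v centered (gotrim_sum \<alpha> X y \<xi> \<tau>)"
proof -
  have "gotrim_sum \<alpha> X y \<xi> (\<tau> + j) = avg_prod \<xi> (\<tau> + j) (Suc \<tau>) *v gotrim_sum \<alpha> X y \<xi> \<tau>"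
    by (rule gotrim_sum_stationary) (simp add: weight_increment_def weights)
  then show ?thesis
    using weights[of \<tau>]
    by (simp add: centered_def matrix_vector_mult_diff_distrib matrix_vector_mult_scaleR
        avg_prod_one[OF edges] gotrim_sum_inner_one[OF edges])
qed

text \<open>With p = max 1 m one has a/p - x = ((a - x) - x (p - 1))/p. Division by p \<ge> 1 does
  not enlarge, and |p - 1| \<le> |m - 1|.\<close>

lemma gotrim_Z_deviation:
  "norm (gotrim_Z \<alpha> X \<xi> t - x *\<^sub>R 1) \<le>
    norm (gotrim_N \<alpha> X \<xi> t - x *\<^sub>R 1) + \<bar>x\<bar> * norm (gotrim_M \<alpha> X \<xi> t - 1)"
proof -
  let ?N = "gotrim_N \<alpha> X \<xi> t - x *\<^sub>R 1" and ?M = "gotrim_M \<alpha> X \<xi> t - 1"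
  have entry: "\<bar>a / max 1 m - x\<bar> \<le> \<bar>a - x\<bar> + \<bar>x\<bar> * \<bar>m - 1\<bar>" for a m :: real
  proof -
    define p where "p = max 1 m"
    have p: "p \<ge> 1" "\<bar>p - 1\<bar> \<le> \<bar>m - 1\<bar>" by (auto simp: p_def)
    have "a / p - x = ((a - x) - x * (p - 1)) / p" using p by (simp add: field_simps)
    then have "\<bar>a / p - x\<bar> = \<bar>(a - x) - x * (p - 1)\<bar> / p" using p by simp
    also have "\<dots> \<le> \<bar>(a - x) - x * (p - 1)\<bar>"
      using p by (simp add: divide_le_eq mult_le_cancel_left1)
    also have "\<dots> \<le> \<bar>a - x\<bar> + \<bar>x * (p - 1)\<bar>" by (rule abs_triangle_ineq4)
    also have "\<dots> \<le> \<bar>a - x\<bar> + \<bar>x\<bar> * \<bar>m - 1\<bar>"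
      using p by (simp add: abs_mult mult_left_mono)
    finally show ?thesis by (simp add: p_def)
  qed
  have "norm (gotrim_Z \<alpha> X \<xi> t - x *\<^sub>R 1) \<le> norm ((\<chi> k. \<bar>?N $ k\<bar>) + \<bar>x\<bar> *\<^sub>R (\<chi> k. \<bar>?M $ k\<bar>))"
    by (intro norm_le_componentwise_cart) (simp add: gotrim_Z_def entry order_trans[OF entry abs_ge_self])
  also have "\<dots> \<le> norm (\<chi> k. \<bar>?N $ k\<bar>) + \<bar>x\<bar> * norm (\<chi> k. \<bar>?M $ k\<bar>)"
    by (rule order_trans[OF norm_triangle_ineq]) simp
  finally show ?thesis by (simp add: norm_vec_def)
qed

end

section \<open>The error bound\<close>

context gossip_graph
begin

lemma rank_estimate_uniform_tail:
  obtains C \<kappa> :: real where "C \<ge> 0" "\<kappa> > 0"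
    "\<And>k t. t \<ge> 1 \<Longrightarrow>
      (LINT \<xi>|edge_seq_measure E. of_bool (\<bar>rank_estimate X \<xi> t k - rank_of X k\<bar> \<ge> 1/2))
        \<le> C * exp (- \<kappa> * t)"
proof -
  let ?I = "\<lambda>k t. LINT \<xi>|edge_seq_measure E. of_bool (\<bar>rank_estimate X \<xi> t k - rank_of X k\<bar> \<ge> 1/2)"
  have "\<exists>C \<kappa> :: real. C \<ge> 0 \<and> \<kappa> > 0 \<and> (\<forall>t\<ge>1. ?I k t \<le> C * exp (- \<kappa> * real t))" for k
    by (rule rank_estimate_tail[of X k]) blast
  then obtain C \<kappa> :: "'n \<Rightarrow> real" where C: "\<And>k. C k \<ge> 0" and \<kappa>: "\<And>k. \<kappa> k > 0"
    and tail: "\<And>k t. t \<ge> 1 \<Longrightarrow> ?I k t \<le> C k * exp (- \<kappa> k * real t)"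
    by metis
  define m where "m = Min (range \<kappa>)"
  have m: "m \<le> \<kappa> k" for k by (simp add: m_def)
  show thesis
  proof (rule that[of "\<Sum>k\<in>UNIV. C k" m])
    show "(\<Sum>k\<in>UNIV. C k) \<ge> 0" using C by (intro sum_nonneg)
    show "m > 0" unfolding m_def using \<kappa> by (subst Min_gr_iff) auto
    fix k and t :: nat assume t: "t \<ge> 1"
    have "?I k t \<le> C k * exp (- \<kappa> k * real t)" by (rule tail[OF t])
    also have "\<dots> \<le> (\<Sum>k\<in>UNIV. C k) * exp (- m * real t)"
    proof (rule mult_mono)
      show "C k \<le> (\<Sum>k\<in>UNIV. C k)" using C by (intro member_le_sum) auto
      show "exp (- \<kappa> k * real t) \<le> exp (- m * real t)"
        using mult_right_mono[OF m[of k], of "real t"] by simp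
    qed (use C in \<open>auto intro: sum_nonneg\<close>)
    finally show "?I k t \<le> (\<Sum>k\<in>UNIV. C k) * exp (- m * real t)" .
  qed
qed

lemma gotrim_error_exponential:
  assumes \<alpha>: "0 < \<alpha>" "\<alpha> < 1/2" and inj: "inj (($) X)"
  obtains K \<rho> :: real where "K \<ge> 0" "0 < \<rho>" "\<rho> < 1"
    "\<And>t. t \<ge> 2 \<Longrightarrow>
      (LINT \<xi>|edge_seq_measure E. norm (gotrim_Z \<alpha> X \<xi> t - trimmed_mean \<alpha> X *\<^sub>R 1))
        \<le> K * (real t + 1)\<^sup>2 * \<rho> ^ (t div 2)"
proof -
  define x where "x = trimmed_mean \<alpha> X"
  define w where "w = (\<chi> k. trim_weight CARD('n) \<alpha> (rank_of X k))"
  have mean_N: "(1 \<bullet> (w * X)) / CARD('n) = x"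
    by (simp add: x_def trimmed_mean_def w_def inner_one_vec)
  have mean_M: "(1 \<bullet> (w * 1)) / CARD('n) = 1"
    using sum_trim_weight_rank[OF \<alpha> inj] by (simp add: w_def inner_one_vec)
  have c: "trim_c CARD('n) \<alpha> > 0" by (rule trim_c_pos[OF \<alpha>]) simp
  define L where "L = (norm X + norm (1 :: real^'n)) / trim_c CARD('n) \<alpha>"
  have L: "L \<ge> 0" using c by (simp add: L_def)
  have sum_le: "norm (gotrim_sum \<alpha> X y \<xi> t) \<le> t * L"
    if "\<And>s. \<xi> s \<in> E" "y = X \<or> y = 1" for \<xi> y t
  proof -
    have "norm (gotrim_sum \<alpha> X y \<xi> t) \<le> t * (norm y / trim_c CARD('n) \<alpha>)"
      by (rule gotrim_sum_norm[OF that(1) \<alpha>])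
    also have "\<dots> \<le> t * L"
      using that(2) c by (intro mult_left_mono) (auto simp: L_def divide_right_mono)
    finally show ?thesis .
  qed
  define K where "K = L * (1 + \<bar>x\<bar>) + 2 * \<bar>x\<bar> * norm (1 :: real^'n)"
  have K: "K \<ge> 0" using L by (simp add: K_def)
  have crude: "norm (gotrim_Z \<alpha> X \<xi> t - x *\<^sub>R 1) \<le> K * (t + 1)" if "\<And>s. \<xi> s \<in> E" for \<xi> t
  proof -
    have "norm (gotrim_Z \<alpha> X \<xi> t - x *\<^sub>R 1) \<le>
        norm (gotrim_N \<alpha> X \<xi> t - x *\<^sub>R 1) + \<bar>x\<bar> * norm (gotrim_M \<alpha> X \<xi> t - 1)"
      by (rule gotrim_Z_deviation)
    also have "\<dots> \<le> (t * L + \<bar>x\<bar> * norm (1 :: real^'n)) + \<bar>x\<bar> * (t * L + norm (1 :: real^'n))"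
      unfolding gotrim_N_eq gotrim_M_eq
      using sum_le[OF that]
      by (intro add_mono mult_left_mono order_trans[OF norm_triangle_ineq4]) auto
    also have "\<dots> = t * (L * (1 + \<bar>x\<bar>)) + 2 * \<bar>x\<bar> * norm (1 :: real^'n)"
      by (simp add: algebra_simps)
    also have "\<dots> \<le> (t + 1) * (L * (1 + \<bar>x\<bar>)) + (t + 1) * (2 * \<bar>x\<bar> * norm (1 :: real^'n))"
    proof -
      have "t * p \<le> (t + 1) * p" "p \<le> (t + 1) * p" if "p \<ge> 0" for p :: real
        using that by (simp_all add: distrib_right)
      then show ?thesis using L by (intro add_mono) auto
    qed
    also have "\<dots> = K * (t + 1)" by (simp add: K_def algebra_simps)
    finally show ?thesis .
  qed
  obtain \<rho>0 :: real where \<rho>0: "0 < \<rho>0" "\<rho>0 < 1"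
    and contraction: "\<And>V s j D. prefix_dependent s V \<Longrightarrow>
      (\<forall>\<xi>. (\<forall>i. \<xi> i \<in> E) \<longrightarrow> 1 \<bullet> V \<xi> = 0 \<and> norm (V \<xi>) \<le> D) \<Longrightarrow>
      (LINT \<xi>|edge_seq_measure E. norm (avg_prod \<xi> (s + j) (Suc s) *v V \<xi>)) \<le> \<rho>0 ^ j * (1 + D\<^sup>2)"
    by (rule avg_prod_expected_contraction) (rule that)
  obtain C \<kappa> :: real where C: "C \<ge> 0" and \<kappa>: "\<kappa> > 0"
    and tail: "\<And>k t. t \<ge> 1 \<Longrightarrow>
      (LINT \<xi>|edge_seq_measure E. of_bool (\<bar>rank_estimate X \<xi> t k - rank_of X k\<bar> \<ge> 1/2))
        \<le> C * exp (- \<kappa> * t)"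
    by (rule rank_estimate_uniform_tail) (rule that)
  define \<rho> where "\<rho> = max \<rho>0 (exp (- \<kappa>))"
  have \<rho>: "0 < \<rho>" "\<rho> < 1" using \<rho>0 \<kappa> by (auto simp: \<rho>_def)
  define K' where "K' = (1 + \<bar>x\<bar>) * (1 + L\<^sup>2) + K * CARD('n) * C"
  show thesis
  proof (rule that[of K' \<rho>])
    show "K' \<ge> 0" using K C by (simp add: K'_def)
    show "0 < \<rho>" "\<rho> < 1" by (rule \<rho>)+
    fix t :: nat assume t: "t \<ge> 2"
    \<comment> \<open>The first half makes late rank errors improbable, the second half averages;
      \<tau> \<le> j lets \<open>\<rho> ^ \<tau>\<close> bound both effects.\<close>
    define \<tau> where "\<tau> = t div 2"
    define j where "j = t - \<tau>"
    have \<tau>: "\<tau> \<ge> 1" "t = \<tau> + j" "\<tau> \<le> j" "\<tau> \<le> t" using t by (auto simp: \<tau>_def j_def)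
    let ?A = "\<lambda>y \<xi>. norm (avg_prod \<xi> (\<tau> + j) (Suc \<tau>) *v centered (gotrim_sum \<alpha> X y \<xi> \<tau>))"
    define b :: "'n \<Rightarrow> nat \<Rightarrow> (nat \<Rightarrow> 'n set) \<Rightarrow> real"
      where "b k s \<xi> = of_bool (\<bar>rank_estimate X \<xi> s k - rank_of X k\<bar> \<ge> 1/2)" for k s \<xi>
    \<comment> \<open>Counts wrong pairs of node and late time: it is at least 1 on the exceptional
      event, and its mean is a union bound.\<close>
    define B where "B \<xi> = (\<Sum>k\<in>UNIV. \<Sum>s=\<tau>..t. b k s \<xi>)" for \<xi>
    let ?U = "\<lambda>\<xi>. ?A X \<xi> + \<bar>x\<bar> * ?A 1 \<xi> + K * (t + 1) * B \<xi>"
    have V: "prefix_dependent \<tau> (\<lambda>\<xi>. centered (gotrim_sum \<alpha> X y \<xi> \<tau>))" for y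
      by (rule prefix_dependent_comp[where g = centered, OF prefix_dependent_gotrim_sum])
    have int_A: "integrable (edge_seq_measure E) (?A y)" for y
      by (rule integrable_prefix_dependent,
          rule prefix_dependent_comp2[where g = "\<lambda>A v. norm (A *v v)", OF prefix_dependent_avg_prod
            prefix_dependent_mono[OF V]]) simp
    have int_b: "integrable (edge_seq_measure E) (b k s)" for k s
      unfolding b_def by (rule integrable_prefix_dependent,
          rule prefix_dependent_comp[where g = "\<lambda>r. of_bool (\<bar>r - rank_of X k\<bar> \<ge> 1/2)",
            OF prefix_dependent_rank_estimate])
    have B0: "B \<xi> \<ge> 0" for \<xi> unfolding B_def b_def by (intro sum_nonneg) auto
    have int_B: "integrable (edge_seq_measure E) B"
      unfolding B_def by (intro Bochner_Integration.integrable_sum int_b)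
    have A_le: "(LINT \<xi>|edge_seq_measure E. ?A y \<xi>) \<le> \<rho> ^ \<tau> * ((t + 1)\<^sup>2 * (1 + L\<^sup>2))"
      if y: "y = X \<or> y = 1" for y
    proof -
      have pow: "\<rho>0 ^ j \<le> \<rho> ^ \<tau>"
      proof (rule order_trans)
        show "\<rho>0 ^ j \<le> \<rho> ^ j" using \<rho>0 by (intro power_mono) (auto simp: \<rho>_def)
        show "\<rho> ^ j \<le> \<rho> ^ \<tau>" using \<rho> \<tau>(3) by (intro power_decreasing) auto
      qed
      have quad: "1 + (\<tau> * L)\<^sup>2 \<le> (t + 1)\<^sup>2 * (1 + L\<^sup>2)"
      proof -
        have "(real \<tau>)\<^sup>2 \<le> (real (t + 1))\<^sup>2" using \<tau>(4) by (intro power_mono) auto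
        moreover have "1 \<le> (real (t + 1))\<^sup>2" by simp
        ultimately have "1 + (real \<tau>)\<^sup>2 * L\<^sup>2 \<le> (real (t + 1))\<^sup>2 + (real (t + 1))\<^sup>2 * L\<^sup>2"
          by (intro add_mono mult_right_mono) auto
        then show ?thesis by (simp add: algebra_simps power_mult_distrib)
      qed
      \<comment> \<open>Here D = \<tau> L is the linear growth bound at time \<tau>; its square is
        one source of the factor (t + 1)^2, the other being the crude bound times the number of late
        times.\<close>
      have "(LINT \<xi>|edge_seq_measure E. ?A y \<xi>) \<le> \<rho>0 ^ j * (1 + (\<tau> * L)\<^sup>2)"
        by (rule contraction[OF V])
          (use y in \<open>auto simp: inner_one_centered intro!: order_trans[OF norm_centered_le sum_le]\<close>)
      also have "\<dots> \<le> \<rho> ^ \<tau> * ((t + 1)\<^sup>2 * (1 + L\<^sup>2))"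
        using \<rho> by (intro mult_mono pow quad) auto
      finally show ?thesis .
    qed
    have B_le: "(LINT \<xi>|edge_seq_measure E. B \<xi>) \<le> CARD('n) * (t + 1) * C * \<rho> ^ \<tau>"
    proof -
      have tail_s: "(LINT \<xi>|edge_seq_measure E. b k s \<xi>) \<le> C * \<rho> ^ \<tau>" if "s \<in> {\<tau>..t}" for k s
      proof -
        have "(LINT \<xi>|edge_seq_measure E. b k s \<xi>) \<le> C * exp (- \<kappa> * s)"
          unfolding b_def using that \<tau>(1) by (intro tail) auto
        also have "\<dots> \<le> C * exp (- \<kappa> * \<tau>)"
          using that \<kappa> C by (intro mult_left_mono) auto
        also have "exp (- \<kappa> * \<tau>) = exp (- \<kappa>) ^ \<tau>" by (simp add: mult.commute flip: exp_of_nat_mult)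
        also have "C * \<dots> \<le> C * \<rho> ^ \<tau>"
          using C by (intro mult_left_mono power_mono) (auto simp: \<rho>_def)
        finally show ?thesis .
      qed
      have "(LINT \<xi>|edge_seq_measure E. B \<xi>) =
          (\<Sum>k\<in>UNIV. \<Sum>s=\<tau>..t. LINT \<xi>|edge_seq_measure E. b k s \<xi>)"
        unfolding B_def by (simp add: Bochner_Integration.integral_sum Bochner_Integration.integrable_sum int_b)
      also have "\<dots> \<le> (\<Sum>k\<in>(UNIV :: 'n set). \<Sum>s=\<tau>..t. C * \<rho> ^ \<tau>)"
        by (intro sum_mono tail_s)
      also have "\<dots> = CARD('n) * (real (Suc t - \<tau>) * (C * \<rho> ^ \<tau>))" by simp
      also have "\<dots> \<le> CARD('n) * (real (t + 1) * (C * \<rho> ^ \<tau>))"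
        using C \<rho> by (intro mult_left_mono mult_right_mono) auto
      finally show ?thesis by (simp add: algebra_simps)
    qed
    have "(LINT \<xi>|edge_seq_measure E. norm (gotrim_Z \<alpha> X \<xi> t - x *\<^sub>R 1)) \<le>
        (LINT \<xi>|edge_seq_measure E. ?U \<xi>)"
    proof (rule integral_mono_AE')
      show "integrable (edge_seq_measure E) ?U"
        by (intro Bochner_Integration.integrable_add integrable_mult_right int_A int_B)
      show "AE \<xi> in edge_seq_measure E. norm (gotrim_Z \<alpha> X \<xi> t - x *\<^sub>R 1) \<le> ?U \<xi>"
        using AE_edges
      proof eventually_elim
        case (elim \<xi>)
        then have edges: "\<And>s. \<xi> s \<in> E" by blast
        show ?case
        proof (cases "\<exists>k. \<exists>s\<in>{\<tau>..t}. \<bar>rank_estimate X \<xi> s k - rank_of X k\<bar> \<ge> 1/2")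
          case True
          then obtain k s where ks: "s \<in> {\<tau>..t}" "\<bar>rank_estimate X \<xi> s k - rank_of X k\<bar> \<ge> 1/2"
            by blast
          have "1 = b k s \<xi>" using ks(2) by (simp add: b_def)
          also have "\<dots> \<le> (\<Sum>s=\<tau>..t. b k s \<xi>)" using ks(1) by (intro member_le_sum) (auto simp: b_def)
          also have "\<dots> \<le> B \<xi>"
            unfolding B_def by (rule member_le_sum) (auto simp: b_def intro!: sum_nonneg)
          finally have "K * (t + 1) * 1 \<le> K * (t + 1) * B \<xi>" using K by (intro mult_left_mono) auto
          then show ?thesis using crude[of \<xi> t, OF edges] by (simp add: add_increasing)
        next
          case False
          have "weight_estimate \<alpha> X \<xi> s = w" if "\<tau> \<le> s" "s \<le> \<tau> + j" for s
            using False that \<tau> by (auto simp: weight_estimate_def w_def vec_eq_iff not_le intro!: trim_weight_eqI[OF \<alpha>])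
          note dev = gotrim_sum_deviation[of \<xi> \<tau> j \<alpha> X w, OF edges this]
          have "norm (gotrim_Z \<alpha> X \<xi> t - x *\<^sub>R 1) \<le>
              norm (gotrim_N \<alpha> X \<xi> t - x *\<^sub>R 1) + \<bar>x\<bar> * norm (gotrim_M \<alpha> X \<xi> t - 1)"
            by (rule gotrim_Z_deviation)
          also have "\<dots> = ?A X \<xi> + \<bar>x\<bar> * ?A 1 \<xi>"
            using dev[where y = X] dev[where y = 1] unfolding mean_N mean_M gotrim_N_eq gotrim_M_eq \<tau>(2) by simp
          finally show ?thesis using K B0 by (simp add: add_increasing2)
        qed
      qed
    qed (use K B0 in auto)
    also have "\<dots> = (LINT \<xi>|edge_seq_measure E. ?A X \<xi>) + \<bar>x\<bar> * (LINT \<xi>|edge_seq_measure E. ?A 1 \<xi>) +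
        K * (t + 1) * (LINT \<xi>|edge_seq_measure E. B \<xi>)"
      using int_A[of X] int_A[of 1] int_B by simp
    also have "\<dots> \<le> \<rho> ^ \<tau> * ((t + 1)\<^sup>2 * (1 + L\<^sup>2)) + \<bar>x\<bar> * (\<rho> ^ \<tau> * ((t + 1)\<^sup>2 * (1 + L\<^sup>2))) +
        K * (t + 1) * (CARD('n) * (t + 1) * C * \<rho> ^ \<tau>)"
      using K by (intro add_mono mult_left_mono A_le B_le) auto
    also have "\<dots> = K' * (real t + 1)\<^sup>2 * \<rho> ^ (t div 2)"
      by (simp add: K'_def \<tau>_def power2_eq_square algebra_simps)
    finally show "(LINT \<xi>|edge_seq_measure E. norm (gotrim_Z \<alpha> X \<xi> t - trimmed_mean \<alpha> X *\<^sub>R 1))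
        \<le> K' * (real t + 1)\<^sup>2 * \<rho> ^ (t div 2)"
      by (simp add: x_def)
  qed
qed

end

section \<open>Comparison with the claimed rate and positivity of the right-hand side\<close>

lemma exponential_le_inverse_sqrt:
  fixes A K \<rho> :: real
  assumes "A > 0" "K \<ge> 0" "0 < \<rho>" "\<rho> < 1"
  obtains T where "\<And>t. real t > real T \<Longrightarrow> t \<ge> 2 \<and> K * (real t + 1)\<^sup>2 * \<rho> ^ (t div 2) \<le> A / sqrt t"
proof -
  \<comment> \<open>After multiplication by sqrt t the polynomial factor is at most cubic. The cube
    root of \<rho> writes (m + 1)^3 \<rho>^m as the cube of (m + 1) \<sigma>^m, which tends to
    0.\<close>
  define \<sigma> where "\<sigma> = root 3 \<rho>"
  have \<sigma>: "0 < \<sigma>" "\<sigma> < 1" "\<sigma> ^ 3 = \<rho>" using assms by (auto simp: \<sigma>_def)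
  have "(\<lambda>m. real m * \<sigma> ^ m + \<sigma> ^ m) \<longlonglongrightarrow> 0 + 0"
    using \<sigma> by (intro tendsto_add powser_times_n_limit_0 LIMSEQ_power_zero) auto
  then have "(\<lambda>m. 8 * K * (real m * \<sigma> ^ m + \<sigma> ^ m) ^ 3) \<longlonglongrightarrow> 8 * K * (0 + 0) ^ 3"
    by (intro tendsto_mult[OF tendsto_const] tendsto_power)
  then have "(\<lambda>m. 8 * K * (real m * \<sigma> ^ m + \<sigma> ^ m) ^ 3) \<longlonglongrightarrow> 0" by simp
  then have "eventually (\<lambda>m. 8 * K * (real m * \<sigma> ^ m + \<sigma> ^ m) ^ 3 < A) sequentially"
    using \<open>A > 0\<close> by (rule order_tendstoD)
  then obtain M where M: "\<And>m. m \<ge> M \<Longrightarrow> 8 * K * (real m * \<sigma> ^ m + \<sigma> ^ m) ^ 3 < A"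
    by (auto simp: eventually_sequentially)
  show thesis
  proof (rule that[of "2 * M + 2"])
    fix t :: nat assume "real t > real (2 * M + 2)"
    then have t: "t > 2 * M + 2" by simp
    define m where "m = t div 2"
    have m: "m \<ge> M" "real t + 1 \<le> 2 * (real m + 1)" using t by (auto simp: m_def)
    have "sqrt t \<le> real t + 1"
      by (rule real_le_lsqrt) (auto simp: power2_eq_square algebra_simps)
    then have "K * (real t + 1)\<^sup>2 * \<rho> ^ m * sqrt t \<le> K * (real t + 1)\<^sup>2 * \<rho> ^ m * (real t + 1)"
      using assms by (intro mult_left_mono) auto
    also have "\<dots> = K * \<rho> ^ m * (real t + 1) ^ 3"
      by (simp add: power2_eq_square power3_eq_cube)
    also have "\<dots> \<le> K * \<rho> ^ m * (2 * (real m + 1)) ^ 3"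
      using assms m by (intro mult_left_mono power_mono) auto
    also have "\<dots> = 8 * K * ((real m + 1) * \<sigma> ^ m) ^ 3"
      unfolding power_mult_distrib \<sigma>(3)[symmetric] by (simp add: mult.commute[of 3] flip: power_mult)
    also have "\<dots> = 8 * K * (real m * \<sigma> ^ m + \<sigma> ^ m) ^ 3"
      by (simp add: distrib_right)
    also have "\<dots> < A" by (rule M[OF m(1)])
    finally show "t \<ge> 2 \<and> K * (real t + 1)\<^sup>2 * \<rho> ^ (t div 2) \<le> A / sqrt t"
      using t by (simp add: m_def le_divide_eq)
  qed
qed

text \<open>On two nodes the only possible edge joins them, and a singleton is then a bipartition
  class.\<close>

lemma card_ge_3_if_not_bipartite:
  fixes E :: "'n::finite set set"
  assumes "undirected_graph E" "\<not> bipartite_graph E" "CARD('n) \<ge> 2"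
  shows "CARD('n) \<ge> 3"
proof (rule ccontr)
  assume "\<not> ?thesis"
  then have "CARD('n) = 2" using assms(3) by simp
  then obtain a b :: 'n where ab: "UNIV = {a, b}" "a \<noteq> b" by (auto simp: card_2_iff)
  have "bipartite_graph E"
    unfolding bipartite_graph_def
  proof (intro exI[of _ "{a}"] ballI)
    fix e assume "e \<in> E"
    then obtain i j where ij: "i \<noteq> j" "e = {i, j}"
      using assms(1) by (auto simp: undirected_graph_def)
    have "i \<in> {a, b}" "j \<in> {a, b}" using ab(1) by blast+
    then have "e = {a, b}" using ij by auto
    then show "\<exists>i j. e = {i, j} \<and> i \<in> {a} \<and> j \<notin> {a}" using ab(2) by auto
  qed
  with assms(2) show False by blast
qed

lemma K_vec_nonzero:
  fixes X :: "real^'n"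
  assumes "\<alpha> < 1/2" and "card {l. X $ l < X $ i} \<noteq> 0"
  shows "K_vec \<alpha> X $ i \<noteq> 0"
proof -
  let ?n = "CARD('n)"
  define j where "j = card {l. X $ l < X $ i}"
  have rank: "rank_of X i = real (Suc j)" by (simp add: rank_of_eq j_def)
  have "j < ?n" unfolding j_def by (intro psubset_card_mono) auto
  moreover have "j > 0" using assms(2) by (simp only: j_def neq0_conv)
  ultimately have \<sigma>: "rank_sigma ?n (rank_of X i) \<noteq> 0"
    by (simp add: rank_sigma_def rank Let_def)
  \<comment> \<open>Doubling clears the half-integers, and parity separates the rank from both
    thresholds. A zero gap would make the entry of \<open>K_vec\<close> 0, since division by 0
    yields 0.\<close>
  have "2 * Suc j \<noteq> 2 * trim_m ?n \<alpha> + 1" "2 * Suc j + 2 * trim_m ?n \<alpha> \<noteq> 2 * ?n + 1"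
    by presburger+
  then have "real (2 * Suc j) \<noteq> real (2 * trim_m ?n \<alpha> + 1)"
      "real (2 * Suc j + 2 * trim_m ?n \<alpha>) \<noteq> real (2 * ?n + 1)"
    by (simp_all only: of_nat_eq_iff not_False_eq_True)
  then have a: "rank_of X i \<noteq> trim_a ?n \<alpha>" and b: "rank_of X i \<noteq> trim_b ?n \<alpha>"
    by (simp_all add: rank trim_a_def trim_b_def field_simps)
  have "rank_gap \<alpha> X i \<noteq> 0" using a b by (simp add: rank_gap_def min_def)
  with \<sigma> assms(1) show ?thesis by (simp add: K_vec_def)
qed

text \<open>The nodes of rank 2 and 3 carry different values, so at most one of them cancels against
  |x|, while \<open>K_vec\<close> is nonzero at both.\<close>

lemma norm_K_vec_pos:
  fixes X :: "real^'n"
  assumes "\<alpha> < 1/2" "inj (($) X)" "CARD('n) \<ge> 3"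
  shows "norm (K_vec \<alpha> X * (X + \<bar>x\<bar> *\<^sub>R 1)) > 0"
proof -
  have node: "\<exists>i. card {l. X $ l < X $ i} = j" if "j < CARD('n)" for j
    using bij_betw_rank[OF assms(2)] that unfolding bij_betw_def
    by (metis (no_types, lifting) imageE lessThan_iff)
  obtain i1 i2 where i: "card {l. X $ l < X $ i1} = 1" "card {l. X $ l < X $ i2} = 2"
    using node[of 1] node[of 2] assms(3) by auto
  then have "X $ i1 \<noteq> X $ i2" by auto
  then have "X $ i1 + \<bar>x\<bar> \<noteq> 0 \<or> X $ i2 + \<bar>x\<bar> \<noteq> 0" by linarith
  then obtain i where "X $ i + \<bar>x\<bar> \<noteq> 0" "i = i1 \<or> i = i2" by blast
  moreover from this(2) have "card {l. X $ l < X $ i} \<noteq> 0"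
    by (metis i zero_neq_one zero_neq_numeral)
  ultimately have "(K_vec \<alpha> X * (X + \<bar>x\<bar> *\<^sub>R 1)) $ i \<noteq> 0"
    using K_vec_nonzero[OF assms(1), of X i] by simp
  then have "K_vec \<alpha> X * (X + \<bar>x\<bar> *\<^sub>R 1) \<noteq> 0" by (metis zero_index)
  then show ?thesis by simp
qed

theorem theorem4:
  fixes \<alpha> :: real
  assumes "CARD('n::finite) \<ge> 2" and "0 < \<alpha>" and "\<alpha> < 1/2"
  shows "\<exists>C0>0. \<forall>(E :: 'n set set) (X :: real^'n).
    undirected_graph E \<and> connected_graph E \<and> \<not> bipartite_graph E \<and> inj (($) X) \<longrightarrow>
    (let xbar = trimmed_mean \<alpha> X;
         c = second_smallest_eigenvalue (graph_laplacian E);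
         lam2 = second_largest_eigenvalue (mean_avg_matrix E);
         c' = 1 - sqrt lam2
     in lam2 = 1 - c / 2 \<and>
        (\<exists>T>0. \<forall>t::nat. real t > T \<longrightarrow>
          (LINT \<omega>|edge_seq_measure E. norm (gotrim_Z \<alpha> X \<omega> t - xbar *\<^sub>R 1))
            \<le> C0 / (c' * sqrt (c * real t)) * norm (K_vec \<alpha> X * (X + \<bar>xbar\<bar> *\<^sub>R 1))))"
proof (intro exI[of _ 1] conjI allI impI)
  fix E :: "'n set set" and X :: "real^'n"
  assume *: "undirected_graph E \<and> connected_graph E \<and> \<not> bipartite_graph E \<and> inj (($) X)"
  then interpret gossip_graph E using assms(1) by unfold_locales auto
  define c where "c = second_smallest_eigenvalue (graph_laplacian E)"
  define x where "x = trimmed_mean \<alpha> X"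
  define lam2 where "lam2 = second_largest_eigenvalue (mean_avg_matrix E)"
  define c' where "c' = 1 - sqrt lam2"
  define k where "k = norm (K_vec \<alpha> X * (X + \<bar>x\<bar> *\<^sub>R 1))"
  have c: "c > 0" and lam2: "lam2 = 1 - c / 2"
    unfolding c_def lam2_def
    by (rule second_smallest_eigenvalue_pos, rule second_largest_eigenvalue_mean_avg)
  \<comment> \<open>lam2 < 1 suffices, \<open>sqrt\<close> being strictly increasing on all
    reals.\<close>
  have c': "c' > 0" using c by (simp add: c'_def lam2)
  have "CARD('n) \<ge> 3" using * assms(1) by (intro card_ge_3_if_not_bipartite[of E]) auto
  then have k: "k > 0" unfolding k_def using * assms(3) by (intro norm_K_vec_pos) auto
  obtain K \<rho> :: real where K: "K \<ge> 0" "0 < \<rho>" "\<rho> < 1"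
    and error: "\<And>t. t \<ge> 2 \<Longrightarrow>
      (LINT \<xi>|edge_seq_measure E. norm (gotrim_Z \<alpha> X \<xi> t - x *\<^sub>R 1))
        \<le> K * (real t + 1)\<^sup>2 * \<rho> ^ (t div 2)"
    by (rule gotrim_error_exponential[OF assms(2,3), of X, folded x_def]) (use * in blast, rule that)
  have "k / (c' * sqrt c) > 0" using c c' k by simp
  then obtain T where T: "\<And>t. real t > real T \<Longrightarrow>
      t \<ge> 2 \<and> K * (real t + 1)\<^sup>2 * \<rho> ^ (t div 2) \<le> k / (c' * sqrt c) / sqrt t"
    using K by (rule exponential_le_inverse_sqrt) (rule that)
  have "lam2 = 1 - c / 2 \<and>
      (\<exists>T>0. \<forall>t::nat. real t > T \<longrightarrow>
        (LINT \<omega>|edge_seq_measure E. norm (gotrim_Z \<alpha> X \<omega> t - x *\<^sub>R 1))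
          \<le> 1 / (c' * sqrt (c * real t)) * k)"
  \<comment> \<open>\<open>T\<close> is a natural number that may be 0; adding 1 makes the threshold
    positive.\<close>
  proof (intro conjI lam2 exI[of _ "real T + 1"] allI impI)
    fix t :: nat assume "real t > real T + 1"
    then have "real t > real T" by simp
    from T[OF this] have "t \<ge> 2" "K * (real t + 1)\<^sup>2 * \<rho> ^ (t div 2) \<le> k / (c' * sqrt c) / sqrt t"
      by auto
    from error[OF this(1)] this(2)
    show "(LINT \<omega>|edge_seq_measure E. norm (gotrim_Z \<alpha> X \<omega> t - x *\<^sub>R 1))
        \<le> 1 / (c' * sqrt (c * real t)) * k"
      by (simp add: real_sqrt_mult mult_ac)
  qed simp
  then show "let xbar = trimmed_mean \<alpha> X;
         c = second_smallest_eigenvalue (graph_laplacian E);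
         lam2 = second_largest_eigenvalue (mean_avg_matrix E);
         c' = 1 - sqrt lam2
     in lam2 = 1 - c / 2 \<and>
        (\<exists>T>0. \<forall>t::nat. real t > T \<longrightarrow>
          (LINT \<omega>|edge_seq_measure E. norm (gotrim_Z \<alpha> X \<omega> t - xbar *\<^sub>R 1))
            \<le> 1 / (c' * sqrt (c * real t)) * norm (K_vec \<alpha> X * (X + \<bar>xbar\<bar> *\<^sub>R 1)))"
    unfolding Let_def c_def c'_def lam2_def x_def k_def .
qed simp

end
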